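(* Let $L$ be a finite meet-distributive lattice with more than one element. The cells $C_{(A,\varepsilon)}$ in $\Sigma_L$ form a regular CW sphere (i.e. a regular CW complex whose underlying space is homeomorphic to a sphere), with face poset $Q_L\setminus\{\hat 0,\hat 1\}$ (the cell $C_{(A,\varepsilon)}$ corresponding to the element $(A,\varepsilon)$) and barycentric subdivision $\pm\Delta$.
   Context: Write $[n]=\{1,\dots,n\}$. A convex closure on $[n]$ is a map $A\mapsto\langle A\rangle$ on subsets of $[n]$ with: $A\subseteq\langle A\rangle$; $A\subseteq B\Rightarrow\langle A\rangle\subseteq\langle B\rangle$; $\langle\langle A\rangle\rangle=\langle A\rangle$; and (anti-exchange) if $x\ne y$, $x,y\notin\langle A\rangle$ and $x\in\langle A\cup\{y\}\rangle$ then $y\notin\langle A\cup\{x\}\rangle$. The closed sets ($A=\langle A\rangle$) ordered by inclusion form a lattice. Every $A\subseteq[n]$ has a unique minimal subset $\operatorname{ext}(A)\subseteq A$ with $\langle\operatorname{ext}(A)\rangle=\langle A\rangle$. A finite lattice $L$ is meet-distributive if for each $y\neq\hat 0$, if $x$ is the meet of all elements covered by $y$, then $[x,y]$ is a Boolean algebra. These are exactly the lattices of closed sets of convex closures: given $L$ with $n$ join-irreducible elements (elements $x\ne\hat 0$ not of the form $y\vee z$ with $y,z<x$), identify $[n]$ with the set of join-irreducibles and put $\langle A\rangle=\{j\in[n] : j\le\bigvee_{i\in A}i\}$; then $L$ is identified with the lattice of closed sets of this convex closure, with $\hat 0=\emptyset$ and $\hat 1=[n]$. Let $\Delta=\Delta(L\setminus\{\hat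 0\})$ be the order complex (simplicial complex of all chains) of $L\setminus\{\hat 0\}$. The simplicial complex $\pm\Delta$: its vertices are equivalence classes of pairs $(A,\varepsilon)$ with $A\in L\setminus\{\hat 0\}$ and $\varepsilon:[n]\to\{\pm1\}$, where $(A,\varepsilon)$ and $(A,\varepsilon')$ are identified when $\varepsilon|_{\operatorname{ext}(A)}=\varepsilon'|_{\operatorname{ext}(A)}$. For $\sigma=\{A_1,\dots,A_k\}\in\Delta$ put $\sigma^\varepsilon=\{(A_1,\varepsilon),\dots,(A_k,\varepsilon)\}$. The faces of $\pm\Delta$ are all $\sigma^\varepsilon$ with $\sigma\in\Delta$, $\varepsilon:[n]\to\{\pm1\}$. The poset $Q_L$: its elements are the equivalence classes of pairs $(A,\varepsilon)$ with $A\in L$, $\varepsilon:[n]\to\{\pm1\}$ (same identification), together with an additional maximum element $\hat 1$. The order is $(A,\varepsilon)\le(B,\delta)$ if and only if $A\subseteq B$ and $\varepsilon,\delta$ agree on $\operatorname{ext}(A)\cap\operatorname{ext}(B)$. The minimum $\hat 0$ of $Q_L$ is the unique class with $A=\emptyset$. The cells: for $A\in L\setminus\{\hat 0\}$ let $\Delta_A=\Delta([\hat 0,A]\setminus\{\hat 0\})\subseteq\Delta$, and let $\pm\Delta_A$ be the subcomplex of $\pm\Delta$ consisting of all $\sigma^\varepsilon$ with $\sigma\in\Delta_A$, $\varepsilon:[n]\to\{\pm1\}$. For $\varepsilon:[n]\to\{\pm1\}$, the cell $C_{(A,\varepsilon)}$ is the star of the vertex $(A,\varepsilon)$ in $\pm\Delta_A$,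 i.e. the union, in the geometric realization $|\pm\Delta|$, of all maximal simplices of $\pm\Delta_A$ containing $(A,\varepsilon)$. $\Sigma_L$ is the collection of all cells $C_{(A,\varepsilon)}$, $A\in L\setminus\{\hat 0\}$. The face poset of a regular CW complex is the set of its (closed, nonempty) cells ordered by inclusion; its barycentric subdivision is the order complex of the face poset. *)

theory Defs
  imports "HOL-Analysis.Analysis"
begin

section \<open>Meet-distributive lattices and their convex closures\<close>

text \<open>
  A finite lattice is a type of class \<open>finite\<close> and \<open>complete_lattice\<close>: every nonempty finite lattice
  is complete, and its bounds and its arbitrary meets and joins are determined by its order.
\<close>

definition covered_by :: "'a::order \<Rightarrow> 'a \<Rightarrow> bool" where
  "covered_by x y \<longleftrightarrow> x < y \<and> \<not> (\<exists>z. x < z \<and> z < y)"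

text \<open>The interval \<open>[x,y]\<close> is a Boolean algebra, i.e. a complemented distributive lattice.\<close>

definition boolean_interval :: "'a::lattice \<Rightarrow> 'a \<Rightarrow> bool" where
  "boolean_interval x y \<longleftrightarrow> x \<le> y \<and>
     (\<forall>a\<in>{x..y}. \<forall>b\<in>{x..y}. \<forall>c\<in>{x..y}. inf a (sup b c) = sup (inf a b) (inf a c)) \<and>
     (\<forall>a\<in>{x..y}. \<exists>b\<in>{x..y}. inf a b = x \<and> sup a b = y)"

definition meet_distributive :: "'a::{finite,complete_lattice} itself \<Rightarrow> bool" where
  "meet_distributive _ \<longleftrightarrow>
     (\<forall>y::'a. y \<noteq> bot \<longrightarrow> boolean_interval (Inf {z. covered_by z y}) y)"

definition join_irreducible :: "'a::{finite,complete_lattice} \<Rightarrow> bool" where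
  "join_irreducible x \<longleftrightarrow> x \<noteq> bot \<and> \<not> (\<exists>y z. y < x \<and> z < x \<and> x = sup y z)"

definition ji_closure :: "'a::{finite,complete_lattice} set \<Rightarrow> 'a set" where
  "ji_closure A = {j. join_irreducible j \<and> j \<le> Sup A}"

text \<open>
  From here on \<open>E\<close> is the ground set and \<open>cl\<close> the closure operator on its subsets.
\<close>

definition closed_sets :: "'b set \<Rightarrow> ('b set \<Rightarrow> 'b set) \<Rightarrow> 'b set set" where
  "closed_sets E cl = {A. A \<subseteq> E \<and> cl A = A}"

definition ext_set :: "('b set \<Rightarrow> 'b set) \<Rightarrow> 'b set \<Rightarrow> 'b set" where
  "ext_set cl A = (THE B. B \<subseteq> A \<and> cl B = cl A \<and> (\<forall>C. C \<subset> B \<longrightarrow> cl C \<noteq> cl A))"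

text \<open>
  The identification of a finite lattice with the lattice of closed sets of its closure \<open>ji_closure\<close>.
\<close>

lemma le_Sup_join_irreducibles:
  fixes x :: "'a::{finite,complete_lattice}"
  shows "x = Sup {j. join_irreducible j \<and> j \<le> x}"
proof (induction "card {z. z < x}" arbitrary: x rule: less_induct)
  case less
  have smaller: "card {z. z < y} < card {z. z < x}" if "y < x" for y
    using that by (intro psubset_card_mono) auto
  show ?case
  proof (cases "x = bot \<or> join_irreducible x")
    case True
    then have "x \<le> Sup {j. join_irreducible j \<and> j \<le> x}"
      by (auto intro: Sup_upper)
    then show ?thesis by (auto intro!: antisym Sup_least)
  next
    case False
    then obtain y z where yz: "y < x" "z < x" "x = sup y z"
      by (auto simp: join_irreducible_def)
    have "w \<le> Sup {j. join_irreducible j \<and> j \<le> x}" if "w < x" for w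
      using less[OF smaller[OF that]] that
      by (metis (mono_tags, lifting) Collect_mono Sup_subset_mono less_imp_le order_trans)
    with yz have "x \<le> Sup {j. join_irreducible j \<and> j \<le> x}"
      by (metis sup_least)
    then show ?thesis by (auto intro!: antisym Sup_least)
  qed
qed

lemma lattice_iso_closed_sets:
  fixes f :: "'a::{finite,complete_lattice} \<Rightarrow> 'a set"
  defines "f \<equiv> \<lambda>x. {j. join_irreducible j \<and> j \<le> x}"
  shows "bij_betw f UNIV (closed_sets {j. join_irreducible j} ji_closure)"
    and "x \<le> y \<longleftrightarrow> f x \<subseteq> f y"
proof -
  have Sf: "Sup (f x) = x" for x
    using le_Sup_join_irreducibles[of x] by (simp add: f_def)
  show "x \<le> y \<longleftrightarrow> f x \<subseteq> f y"
    by (metis (mono_tags, lifting) Collect_mono Sf Sup_subset_mono f_def order_trans)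
  have "inj f" by (metis Sf injI)
  moreover have "range f = closed_sets {j. join_irreducible j} ji_closure"
  proof (intro equalityI subsetI)
    fix A assume "A \<in> range f"
    then obtain x where "A = f x" by auto
    then show "A \<in> closed_sets {j. join_irreducible j} ji_closure"
      by (simp add: closed_sets_def ji_closure_def Sf) (auto simp: f_def)
  next
    fix A :: "'a set" assume "A \<in> closed_sets {j. join_irreducible j} ji_closure"
    then have "A = f (Sup A)" by (auto simp: closed_sets_def ji_closure_def f_def)
    then show "A \<in> range f" by blast
  qed
  ultimately show "bij_betw f UNIV (closed_sets {j. join_irreducible j} ji_closure)"
    by (simp add: bij_betw_def)
qed

section \<open>The complex \<open>\<plusminus>\<Delta>\<close> and the poset \<open>Q\<close>\<close>

definition sign_vectors :: "'b set \<Rightarrow> ('b \<Rightarrow> int) set" where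
  "sign_vectors E = E \<rightarrow>\<^sub>E {-1, 1}"

text \<open>A signed set is an equivalence class of pairs \<open>(A,\<epsilon>)\<close>.\<close>

type_synonym 'b signed = "('b set \<times> ('b \<Rightarrow> int)) set"

definition sign_rel ::
  "'b set \<Rightarrow> ('b set \<Rightarrow> 'b set) \<Rightarrow> (('b set \<times> ('b \<Rightarrow> int)) \<times> ('b set \<times> ('b \<Rightarrow> int))) set" where
  "sign_rel E cl =
     {((A, \<epsilon>), (B, \<delta>)). A \<in> closed_sets E cl \<and> \<epsilon> \<in> sign_vectors E \<and> \<delta> \<in> sign_vectors E \<and>
        A = B \<and> (\<forall>x\<in>ext_set cl A. \<epsilon> x = \<delta> x)}"

definition signed_set ::
  "'b set \<Rightarrow> ('b set \<Rightarrow> 'b set) \<Rightarrow> 'b set \<Rightarrow> ('b \<Rightarrow> int) \<Rightarrow> 'b signed" where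
  "signed_set E cl A \<epsilon> = sign_rel E cl `` {(A, \<epsilon>)}"

text \<open>
  A simplicial complex is given by its set of faces; the empty face is included.
  All posets of which an order complex is taken are families of sets ordered by inclusion.
\<close>

definition order_complex :: "'b set set \<Rightarrow> 'b set set set" where
  "order_complex P = {\<sigma> \<in> chains P. finite \<sigma>}"

definition pm_complex ::
  "'b set \<Rightarrow> ('b set \<Rightarrow> 'b set) \<Rightarrow> 'b set set set \<Rightarrow> 'b signed set set" where
  "pm_complex E cl K = {(\<lambda>A. signed_set E cl A \<epsilon>) ` \<sigma> | \<sigma> \<epsilon>. \<sigma> \<in> K \<and> \<epsilon> \<in> sign_vectors E}"

definition pm_Delta :: "'b set \<Rightarrow> ('b set \<Rightarrow> 'b set) \<Rightarrow> 'b signed set set" where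
  "pm_Delta E cl = pm_complex E cl (order_complex (closed_sets E cl - {{}}))"

definition pm_Delta_below :: "'b set \<Rightarrow> ('b set \<Rightarrow> 'b set) \<Rightarrow> 'b set \<Rightarrow> 'b signed set set" where
  "pm_Delta_below E cl A =
     pm_complex E cl (order_complex ({B \<in> closed_sets E cl. B \<subseteq> A} - {{}}))"

text \<open>\<open>Elt\<close> injects the signed sets into \<open>Q\<close>; \<open>Hat1\<close> is the additional maximum.\<close>

datatype 'c with_max = Elt 'c | Hat1

definition Q_poset :: "'b set \<Rightarrow> ('b set \<Rightarrow> 'b set) \<Rightarrow> 'b signed with_max set" where
  "Q_poset E cl =
     {Elt (signed_set E cl A \<epsilon>) | A \<epsilon>. A \<in> closed_sets E cl \<and> \<epsilon> \<in> sign_vectors E} \<union> {Hat1}"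

fun Q_le :: "('b set \<Rightarrow> 'b set) \<Rightarrow> 'b signed with_max \<Rightarrow> 'b signed with_max \<Rightarrow> bool" where
  "Q_le cl _ Hat1 = True"
| "Q_le cl Hat1 (Elt _) = False"
| "Q_le cl (Elt X) (Elt Y) =
     (\<exists>(A, \<epsilon>)\<in>X. \<exists>(B, \<delta>)\<in>Y. A \<subseteq> B \<and> (\<forall>x\<in>ext_set cl A \<inter> ext_set cl B. \<epsilon> x = \<delta> x))"

text \<open>As \<open>ext \<emptyset> = \<emptyset>\<close>, all pairs \<open>(\<emptyset>,\<epsilon>)\<close> form a single class.\<close>

definition Q_bot :: "'b set \<Rightarrow> 'b signed with_max" where
  "Q_bot E = Elt ({{}} \<times> sign_vectors E)"

section \<open>Geometric realization and cells\<close>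

text \<open>
  Points of the geometric realization are given by their barycentric coordinates. The realization
  carries the subspace topology of the product topology on functions, which for a finite complex
  is its usual topology.
\<close>

definition geom_simplex :: "'v set \<Rightarrow> ('v \<Rightarrow> real) set" where
  "geom_simplex \<sigma> = {t. (\<forall>v. 0 \<le> t v) \<and> (\<forall>v. v \<notin> \<sigma> \<longrightarrow> t v = 0) \<and> (\<Sum>v\<in>\<sigma>. t v) = 1}"

definition realization :: "'v set set \<Rightarrow> ('v \<Rightarrow> real) set" where
  "realization K = (\<Union>\<sigma>\<in>K. geom_simplex \<sigma>)"

definition maximal_faces :: "'v set set \<Rightarrow> 'v set set" where
  "maximal_faces K = {\<sigma> \<in> K. \<forall>\<tau>\<in>K. \<sigma> \<subseteq> \<tau> \<longrightarrow> \<tau> = \<sigma>}"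

definition geom_star :: "'v set set \<Rightarrow> 'v \<Rightarrow> ('v \<Rightarrow> real) set" where
  "geom_star K v = (\<Union>\<sigma>\<in>{\<sigma> \<in> maximal_faces K. v \<in> \<sigma>}. geom_simplex \<sigma>)"

definition cell ::
  "'b set \<Rightarrow> ('b set \<Rightarrow> 'b set) \<Rightarrow> 'b set \<Rightarrow> ('b \<Rightarrow> int) \<Rightarrow> ('b signed \<Rightarrow> real) set" where
  "cell E cl A \<epsilon> = geom_star (pm_Delta_below E cl A) (signed_set E cl A \<epsilon>)"

definition Sigma_cells ::
  "'b set \<Rightarrow> ('b set \<Rightarrow> 'b set) \<Rightarrow> ('b signed \<Rightarrow> real) set set" where
  "Sigma_cells E cl =
     {cell E cl A \<epsilon> | A \<epsilon>. A \<in> closed_sets E cl - {{}} \<and> \<epsilon> \<in> sign_vectors E}"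

section \<open>Regular CW complexes\<close>

definition nball :: "nat \<Rightarrow> (nat \<Rightarrow> real) topology" where
  "nball d = subtopology (Euclidean_space d) {x. (\<Sum>i<d. (x i)\<^sup>2) \<le> 1}"

definition nball_interior :: "nat \<Rightarrow> (nat \<Rightarrow> real) set" where
  "nball_interior d = {x \<in> topspace (nball d). (\<Sum>i<d. (x i)\<^sup>2) < 1}"

definition nball_boundary :: "nat \<Rightarrow> (nat \<Rightarrow> real) set" where
  "nball_boundary d = {x \<in> topspace (nball d). (\<Sum>i<d. (x i)\<^sup>2) = 1}"

text \<open>
  A regular CW structure on the space \<open>X\<close>, given by its set of closed cells: the characteristic
  map \<open>\<Phi> C\<close> of each closed cell \<open>C\<close> is a homeomorphism from a ball onto \<open>C\<close>, the open cells
  partition \<open>X\<close>, the boundary of each cell lies in a finite union of open cells of lower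
  dimension, and \<open>X\<close> has the weak topology with respect to the closed cells.
\<close>

definition regular_CW_complex :: "'p topology \<Rightarrow> 'p set set \<Rightarrow> bool" where
  "regular_CW_complex X \<Sigma> \<longleftrightarrow> Hausdorff_space X \<and>
     (\<exists>(dm :: 'p set \<Rightarrow> nat) (\<Phi> :: 'p set \<Rightarrow> (nat \<Rightarrow> real) \<Rightarrow> 'p).
        (\<forall>C\<in>\<Sigma>. C \<subseteq> topspace X \<and> homeomorphic_map (nball (dm C)) (subtopology X C) (\<Phi> C)) \<and>
        disjoint_family_on (\<lambda>C. \<Phi> C ` nball_interior (dm C)) \<Sigma> \<and>
        (\<Union>C\<in>\<Sigma>. \<Phi> C ` nball_interior (dm C)) = topspace X \<and>
        (\<forall>C\<in>\<Sigma>. \<exists>F. finite F \<and> F \<subseteq> {D \<in> \<Sigma>. dm D < dm C} \<and>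
           \<Phi> C ` nball_boundary (dm C) \<subseteq> (\<Union>D\<in>F. \<Phi> D ` nball_interior (dm D))) \<and>
        (\<forall>S. S \<subseteq> topspace X \<longrightarrow> (closedin X S \<longleftrightarrow> (\<forall>C\<in>\<Sigma>. closedin X (S \<inter> C)))))"

definition regular_CW_sphere :: "'p topology \<Rightarrow> 'p set set \<Rightarrow> bool" where
  "regular_CW_sphere X \<Sigma> \<longleftrightarrow> regular_CW_complex X \<Sigma> \<and> (\<exists>d. X homeomorphic_space nsphere d)"

definition poset_isomorphism ::
  "'c set \<Rightarrow> ('c \<Rightarrow> 'c \<Rightarrow> bool) \<Rightarrow> 'd set \<Rightarrow> ('d \<Rightarrow> 'd \<Rightarrow> bool) \<Rightarrow> ('c \<Rightarrow> 'd) \<Rightarrow> bool" where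
  "poset_isomorphism P leP R leR f \<longleftrightarrow>
     bij_betw f P R \<and> (\<forall>x\<in>P. \<forall>y\<in>P. leP x y \<longleftrightarrow> leR (f x) (f y))"

definition simplicial_isomorphism :: "'v set set \<Rightarrow> 'w set set \<Rightarrow> ('v \<Rightarrow> 'w) \<Rightarrow> bool" where
  "simplicial_isomorphism K M f \<longleftrightarrow> inj_on f (\<Union>K) \<and> (\<lambda>\<sigma>. f ` \<sigma>) ` K = M"

end

theory Submission
  imports Defs
begin

text \<open>
  Write \<open>1\<^sub>S\<close> for the indicator of \<open>S\<close>. Every nonnegative function on \<open>E\<close> is uniquely a
  nonnegative combination of the \<open>1\<^bsub>ext A\<^esub>\<close> whose nonzero coefficients sit on a chain of
  closed sets: the top set must be the closure of the support, and its coefficient the minimum over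
  its extreme points. Hence the piecewise linear map sending the vertex \<open>(A,\<epsilon>)\<close> to
  \<open>\<epsilon> 1\<^bsub>ext A\<^esub>\<close> maps \<open>|\<plusminus>\<Delta>|\<close> to a set meeting every ray of \<open>\<real>\<^sup>E\<close> from the
  origin exactly once, which makes \<open>|\<plusminus>\<Delta>|\<close> a sphere. Under this map the cell of \<open>(A,\<epsilon>)\<close> is the
  preimage of the cone of vectors supported on \<open>A\<close> whose signs on \<open>ext A\<close> do not disagree with \<open>\<epsilon>\<close>.
  A vector \<open>v\<close> lies in the relative interior of exactly one such cone, the one with
  \<open>A = \<langle>supp v\<rangle>\<close> and \<open>\<epsilon> = sgn v\<close> on \<open>ext A\<close>.
\<close>

section \<open>Extreme points in meet-distributive lattices\<close>

text \<open>Two facts carry the argument. Signs never cancel: all vertices of a face of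
  \<open>pm_Delta\<close> share one sign vector, so the image of a point has at x the sign
  \<epsilon> x and an absolute value independent of \<epsilon>; injectivity on rays thereby reduces
  to the unsigned decomposition. That decomposition rests on extreme points: a closed set containing
  \<open>ext A\<close> contains A, so the top set of a chain always has an extreme point outside all
  other sets of the chain. Anti-exchange enters as the existence of a least spanning subset, which
  first has to be derived from the Boolean intervals. The cone of (A,\<epsilon>) is an orthant in
  the coordinates of \<open>ext A\<close> times a linear space in the remaining coordinates of A.
  Since \<open>ext A\<close> is nonempty for nonempty A, the rays of this cone form a ball, of
  dimension \<open>card A - 1\<close>, and not a sphere. The homeomorphisms from the realization to
  the sphere and from balls to cells are obtained as continuous bijections from a compact space to a
  Hausdorff space, so that only the behaviour on rays has to be computed.\<close>

lemma exists_join_irreducible: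
  fixes a b :: "'a::{finite,complete_lattice}"
  assumes "\<not> a \<le> b"
  obtains j where "join_irreducible j" "j \<le> a" "\<not> j \<le> b"
proof -
  have "\<exists>j. join_irreducible j \<and> j \<le> a \<and> \<not> j \<le> b"
    using assms le_Sup_join_irreducibles[of a] by (metis (mono_tags, lifting) Sup_least mem_Collect_eq)
  then show ?thesis using that by blast
qed

lemma exists_lower_cover:
  fixes x y :: "'a::{finite,order}"
  assumes "x < y"
  obtains z where "covered_by z y" "x \<le> z"
proof -
  have "\<exists>z\<in>{z. z < y}. x \<le> z \<and> (\<forall>b\<in>{z. z < y}. z \<le> b \<longrightarrow> z = b)"
    using finite_has_maximal2[of "{z. z < y}" x] assms by auto
  then obtain z where "z < y" "x \<le> z" "\<forall>b. b < y \<and> z \<le> b \<longrightarrow> z = b" by auto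
  then show ?thesis using that[of z] by (metis covered_by_def order.strict_implies_order order.strict_implies_not_eq)
qed

lemma sup_distinct_lower_covers:
  fixes y :: "'a::lattice"
  assumes "covered_by z y" "w \<le> y" "\<not> w \<le> z"
  shows "sup w z = y"
proof -
  have "z < sup w z" by (metis assms(3) sup.cobounded1 sup.cobounded2 order.not_eq_order_implies_strict)
  moreover have "sup w z \<le> y" using assms by (simp add: covered_by_def less_imp_le)
  ultimately show ?thesis using assms(1) by (meson covered_by_def order.not_eq_order_implies_strict)
qed

text \<open>This is anti-exchange in lattice form: passing to a lower cover loses exactly one point.
  Induct on the size of the ideal below y. Two lost points j and j' lie below lower covers z1 and z2
  other than z. The meet of z1 and z2 is not below z, so it contains some lost point i. The
  induction hypothesis inside z1 gives j = i, and inside z2 it gives j' = i.\<close>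

lemma lower_cover_unique_join_irreducible:
  fixes y :: "'a::{finite,complete_lattice}"
  assumes md: "meet_distributive TYPE('a)"
  shows "\<lbrakk>covered_by z y; join_irreducible j; j \<le> y; \<not> j \<le> z;
     join_irreducible j'; j' \<le> y; \<not> j' \<le> z\<rbrakk> \<Longrightarrow> j = j'"
proof (induction "card {w. w < y}" arbitrary: y z j j' rule: less_induct)
  case less
  have smaller: "card {w. w < u} < card {w. w < y}" if "u < y" for u
    using that by (intro psubset_card_mono) auto
  define x where "x = Inf {z. covered_by z y}"
  have zy: "z < y" using less.prems(1) by (simp add: covered_by_def)
  then have "y \<noteq> bot" by auto
  then have "boolean_interval x y" using md by (simp add: meet_distributive_def x_def)
  then have distr: "inf a (sup b c) = sup (inf a b) (inf a c)"
    if "a \<in> {x..y}" "b \<in> {x..y}" "c \<in> {x..y}" for a b c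
    using that by (simp add: boolean_interval_def)
  have cov_mem: "w \<in> {x..y}" if "covered_by w y" for w
    using that by (auto simp: x_def covered_by_def intro: Inf_lower)
  have cov_le: "\<not> v \<le> w" if "covered_by v y" "covered_by w y" "v \<noteq> w" for v w
    using that by (metis covered_by_def order.not_eq_order_implies_strict)
  \<comment> \<open>An element v strictly between would satisfy sup v z = y, and distributivity then
    forces v = w. Hence the induction hypothesis applies to w with the lower cover inf z w.\<close>
  have cov_meet: "covered_by (inf z w) w" if "covered_by w y" "w \<noteq> z" for w
    unfolding covered_by_def
  proof (intro conjI notI)
    show "inf z w < w"
      using cov_le[OF that(1) less.prems(1)] that
      by (metis inf.cobounded1 inf.cobounded2 order.not_eq_order_implies_strict)
    assume "\<exists>v. inf z w < v \<and> v < w"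
    then obtain v where v: "inf z w < v" "v < w" by auto
    have wy: "w < y" using that by (simp add: covered_by_def)
    have "x \<le> inf z w" using cov_mem less.prems(1) that(1) by auto
    then have vm: "v \<in> {x..y}" using v wy by (meson atLeastAtMost_iff less_imp_le order_trans)
    have "\<not> v \<le> z" using v by (metis inf.boundedI leD less_imp_le)
    then have "sup v z = y" using sup_distinct_lower_covers[OF less.prems(1)] vm by simp
    then have "w = inf w (sup v z)" using wy by (simp add: inf.absorb1 less_imp_le)
    also have "\<dots> = sup (inf w v) (inf w z)"
      using distr cov_mem less.prems(1) that(1) vm by blast
    also have "\<dots> = v" using v by (metis inf.absorb2 inf.commute less_imp_le sup.absorb1)
    finally show False using v by simp
  qed
  have below: "j1 = j2" if "covered_by w y" "w \<noteq> z" "join_irreducible j1" "join_irreducible j2"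
      "j1 \<le> w" "j2 \<le> w" "\<not> j1 \<le> z" "\<not> j2 \<le> z" for j1 j2 w
    using less.hyps[OF smaller cov_meet[OF that(1,2)], of j1 j2] that
    by (auto simp: covered_by_def)
  have proper: "\<exists>w. covered_by w y \<and> w \<noteq> z \<and> i \<le> w"
    if i: "i \<le> y" "\<not> i \<le> z" and k: "i \<noteq> k" "k \<le> y" "\<not> k \<le> z" and ij: "join_irreducible i" for i k
  proof -
    \<comment> \<open>The second lost point k is what excludes i = y: otherwise y would be the join
      of the smaller elements k and z and could not be join-irreducible.\<close>
    have "i \<noteq> y"
    proof
      assume "i = y"
      then have "k < i" using k by auto
      moreover have "sup k z = i" using sup_distinct_lower_covers less.prems(1) k \<open>i = y\<close> by blast
      ultimately show False using ij zy \<open>i = y\<close> unfolding join_irreducible_def by blast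
    qed
    then obtain w where "covered_by w y" "i \<le> w" using exists_lower_cover i(1)
      by (metis order.not_eq_order_implies_strict)
    then show ?thesis using i by auto
  qed
  show ?case
  proof (rule ccontr)
    assume ne: "j \<noteq> j'"
    obtain z1 where z1: "covered_by z1 y" "z1 \<noteq> z" "j \<le> z1"
      using proper[of j j'] less.prems ne by blast
    obtain z2 where z2: "covered_by z2 y" "z2 \<noteq> z" "j' \<le> z2"
      using proper[of j' j] less.prems ne by blast
    \<comment> \<open>In a distributive interval the coatom z is meet-prime, and neither z1 nor z2
      lies below it.\<close>
    have "\<not> inf z1 z2 \<le> z"
    proof
      assume le: "inf z1 z2 \<le> z"
      have "sup z2 z = y"
        using sup_distinct_lower_covers[OF less.prems(1)] cov_le z2 less.prems(1)
        by (simp add: covered_by_def less_imp_le)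
      then have "z1 = inf z1 (sup z2 z)" using z1 by (simp add: inf.absorb1 less_imp_le covered_by_def)
      also have "\<dots> = sup (inf z1 z2) (inf z1 z)"
        using distr cov_mem less.prems(1) z1 z2 by blast
      also have "\<dots> \<le> z" using le by simp
      finally show False using cov_le z1 less.prems(1) by blast
    qed
    then obtain i where "join_irreducible i" "i \<le> inf z1 z2" "\<not> i \<le> z"
      using exists_join_irreducible by blast
    then have "j = i" "j' = i"
      using below[OF z1(1,2), of j i] below[OF z2(1,2), of j' i] less.prems z1 z2 by auto
    then show False using ne by simp
  qed
qed

text \<open>A set with join y must contain, for each lower cover z of y, an element not below z, and
  there is only one candidate by \<open>lower_cover_unique_join_irreducible\<close>. Collecting
  these forced elements over all z already gives join y, since their join lies below no lower
  cover.\<close>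

lemma minimal_join_representation:
  fixes y :: "'a::{finite,complete_lattice}"
  assumes md: "meet_distributive TYPE('a)"
  obtains B where "B \<subseteq> {j. join_irreducible j}" "Sup B = y"
    "\<And>S. S \<subseteq> {j. join_irreducible j} \<Longrightarrow> Sup S = y \<Longrightarrow> B \<subseteq> S"
proof -
  define B where "B = {j. join_irreducible j \<and> j \<le> y \<and> (\<exists>z. covered_by z y \<and> \<not> j \<le> z)}"
  have "Sup B = y"
  proof (rule ccontr)
    assume "Sup B \<noteq> y"
    moreover have "Sup B \<le> y" by (auto simp: B_def intro: Sup_least)
    ultimately obtain z where z: "covered_by z y" "Sup B \<le> z"
      using exists_lower_cover by (metis order.not_eq_order_implies_strict)
    then have "\<not> y \<le> z" by (auto simp: covered_by_def)
    then obtain j where j: "join_irreducible j" "j \<le> y" "\<not> j \<le> z" using exists_join_irreducible by blast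
    then have "j \<in> B" using z by (auto simp: B_def)
    then show False using j z by (meson Sup_upper order_trans)
  qed
  moreover have "B \<subseteq> S" if S: "S \<subseteq> {j. join_irreducible j}" "Sup S = y" for S
  proof
    fix j assume "j \<in> B"
    then obtain z where j: "join_irreducible j" "j \<le> y" and z: "covered_by z y" "\<not> j \<le> z"
      by (auto simp: B_def)
    have "\<not> Sup S \<le> z" using z S by (auto simp: covered_by_def)
    then obtain i where i: "i \<in> S" "\<not> i \<le> z" by (meson Sup_least)
    then have "i \<le> y" "join_irreducible i" using S by (auto intro: Sup_upper)
    then have "i = j" using lower_cover_unique_join_irreducible[OF md z(1)] i j z by blast
    then show "j \<in> S" using i by simp
  qed
  ultimately show ?thesis using that[of B] by (auto simp: B_def)
qed

section \<open>Convex closures\<close>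

text \<open>Anti-exchange takes the form in which it is applied: \<open>minimal_spanning\<close>
  provides a least spanning subset of each closed set, not merely a minimal one.\<close>

locale convex_closure =
  fixes E :: "'b set" and cl :: "'b set \<Rightarrow> 'b set"
  assumes finite_ground: "finite E"
    and cl_subset: "\<And>A. A \<subseteq> E \<Longrightarrow> cl A \<subseteq> E"
    and cl_extensive: "\<And>A. A \<subseteq> E \<Longrightarrow> A \<subseteq> cl A"
    and cl_mono: "\<And>A B. A \<subseteq> B \<Longrightarrow> B \<subseteq> E \<Longrightarrow> cl A \<subseteq> cl B"
    and cl_idem: "\<And>A. A \<subseteq> E \<Longrightarrow> cl (cl A) = cl A"
    and cl_empty: "cl {} = {}"
    and minimal_spanning: "\<And>A. A \<in> closed_sets E cl \<Longrightarrow>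
      \<exists>B\<subseteq>A. cl B = A \<and> (\<forall>S\<subseteq>A. cl S = A \<longrightarrow> B \<subseteq> S)"

lemma convex_closure_ji_closure:
  assumes md: "meet_distributive TYPE('a::{finite,complete_lattice})"
  shows "convex_closure {j::'a. join_irreducible j} ji_closure"
proof
  let ?J = "{j::'a. join_irreducible j}"
  have Sup_cl: "Sup (ji_closure A) = Sup A" for A :: "'a set"
    unfolding ji_closure_def using le_Sup_join_irreducibles[of "Sup A"] by simp
  show "finite ?J" by simp
  show "ji_closure A \<subseteq> ?J" for A :: "'a set" by (auto simp: ji_closure_def)
  show ext: "A \<subseteq> ji_closure A" if "A \<subseteq> ?J" for A :: "'a set"
    using that by (auto simp: ji_closure_def intro: Sup_upper)
  show "ji_closure A \<subseteq> ji_closure B" if "A \<subseteq> B" for A B :: "'a set"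
    using Sup_subset_mono[OF that] by (auto simp: ji_closure_def)
  show "ji_closure (ji_closure A) = ji_closure A" for A :: "'a set"
    using Sup_cl[of A] by (simp add: ji_closure_def)
  show "ji_closure {} = ({} :: 'a set)"
    by (auto simp: ji_closure_def join_irreducible_def bot_unique)
  fix A :: "'a set" assume A: "A \<in> closed_sets ?J ji_closure"
  obtain B where B: "B \<subseteq> ?J" "Sup B = Sup A" "\<And>S. S \<subseteq> ?J \<Longrightarrow> Sup S = Sup A \<Longrightarrow> B \<subseteq> S"
    using minimal_join_representation[OF md] by metis
  have A': "A \<subseteq> ?J" "ji_closure A = A" using A by (auto simp: closed_sets_def)
  have "B \<subseteq> S" if "S \<subseteq> A" "ji_closure S = A" for S
    using B(3)[of S] that A' Sup_cl[of S] by auto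
  moreover have "ji_closure B = A" using A' B(2) by (simp add: ji_closure_def)
  moreover have "B \<subseteq> A" using B(3) A' by blast
  ultimately show "\<exists>B\<subseteq>A. ji_closure B = A \<and> (\<forall>S\<subseteq>A. ji_closure S = A \<longrightarrow> B \<subseteq> S)"
    by (intro exI[of _ B]) auto
qed

context convex_closure
begin

abbreviation "\<L> \<equiv> closed_sets E cl"
abbreviation "ext \<equiv> ext_set cl"
abbreviation "signs \<equiv> sign_vectors E"
abbreviation "vertex A \<epsilon> \<equiv> signed_set E cl A \<epsilon>"

lemma closed_subset: "A \<in> \<L> \<Longrightarrow> A \<subseteq> E"
  and closed_cl: "A \<in> \<L> \<Longrightarrow> cl A = A"
  by (auto simp: closed_sets_def)

lemma cl_closed: "A \<subseteq> E \<Longrightarrow> cl A \<in> \<L>"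
  by (simp add: closed_sets_def cl_subset cl_idem)

lemma finite_closed_sets: "finite \<L>"
  using finite_ground by (auto simp: closed_sets_def intro: finite_subset[of _ "Pow E"])

lemma finite_closed: "A \<in> \<L> \<Longrightarrow> finite A"
  using closed_subset finite_ground finite_subset by blast

text \<open>A least spanning subset is in particular the only minimal one, so the definite
  description in \<open>ext_set\<close> denotes it.\<close>

lemma ext_properties:
  assumes "A \<in> \<L>"
  shows ext_subset: "ext A \<subseteq> A" and cl_ext: "cl (ext A) = A"
    and ext_least: "\<And>S. S \<subseteq> A \<Longrightarrow> cl S = A \<Longrightarrow> ext A \<subseteq> S"
proof -
  obtain B where B: "B \<subseteq> A" "cl B = A" "\<And>S. S \<subseteq> A \<Longrightarrow> cl S = A \<Longrightarrow> B \<subseteq> S"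
    using minimal_spanning[OF assms] by auto
  have "ext A = B"
    unfolding ext_set_def closed_cl[OF assms]
  proof (rule the_equality)
    show "B \<subseteq> A \<and> cl B = A \<and> (\<forall>C. C \<subset> B \<longrightarrow> cl C \<noteq> A)"
      using B by (metis dual_order.trans leD psubsetE)
    show "C = B" if "C \<subseteq> A \<and> cl C = A \<and> (\<forall>D. D \<subset> C \<longrightarrow> cl D \<noteq> A)" for C
      using that B by (metis psubsetI)
  qed
  then show "ext A \<subseteq> A" "cl (ext A) = A" "\<And>S. S \<subseteq> A \<Longrightarrow> cl S = A \<Longrightarrow> ext A \<subseteq> S"
    using B by auto
qed

lemma ext_ground: "A \<in> \<L> \<Longrightarrow> x \<in> ext A \<Longrightarrow> x \<in> E"
  using ext_subset closed_subset by blast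

lemma finite_ext: "A \<in> \<L> \<Longrightarrow> finite (ext A)"
  using ext_subset finite_closed finite_subset by blast

lemma ext_nonempty: "A \<in> \<L> \<Longrightarrow> A \<noteq> {} \<Longrightarrow> ext A \<noteq> {}"
  using cl_ext cl_empty by metis

lemma closed_subset_if_ext_subset:
  assumes "A \<in> \<L>" "B \<in> \<L>" "ext A \<subseteq> B"
  shows "A \<subseteq> B"
  using cl_mono[OF assms(3)] assms cl_ext closed_cl closed_subset by metis

text \<open>If x were not extreme in A, then \<open>ext A\<close> would avoid x, so A, and with it
  x, would lie in the closure of B - {x}. Then B - {x} spans B, although every spanning subset of B
  contains \<open>ext B\<close>.\<close>

lemma ext_hereditary:
  assumes "A \<in> \<L>" "B \<in> \<L>" "A \<subseteq> B" "x \<in> ext B" "x \<in> A"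
  shows "x \<in> ext A"
proof (rule ccontr)
  assume "x \<notin> ext A"
  have BE: "B \<subseteq> E" using assms closed_subset by blast
  have "ext A \<subseteq> B - {x}" using \<open>x \<notin> ext A\<close> ext_subset[OF assms(1)] assms(3) by auto
  then have "A \<subseteq> cl (B - {x})"
    using cl_mono[of "ext A" "B - {x}"] cl_ext[OF assms(1)] BE by auto
  then have "B \<subseteq> cl (B - {x})" using cl_extensive[of "B - {x}"] BE assms(5) by auto
  moreover have "cl (B - {x}) \<subseteq> B" using cl_mono[of "B - {x}" B] BE closed_cl[OF assms(2)] by auto
  ultimately have "ext B \<subseteq> B - {x}" using ext_least[OF assms(2)] by blast
  then show False using assms(4) by auto
qed

lemma empty_closed: "{} \<in> \<L>"
  by (simp add: closed_sets_def cl_empty)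

lemma signs_cases: "\<epsilon> \<in> signs \<Longrightarrow> x \<in> E \<Longrightarrow> \<epsilon> x = 1 \<or> \<epsilon> x = -1"
  by (auto simp: sign_vectors_def)

lemma signs_mult_self: "\<epsilon> \<in> signs \<Longrightarrow> x \<in> E \<Longrightarrow> \<epsilon> x * \<epsilon> x = 1"
  using signs_cases by fastforce

lemma finite_signs: "finite signs"
  unfolding sign_vectors_def by (intro finite_PiE finite_ground) auto

lemma vertex_eq:
  "A \<in> \<L> \<Longrightarrow> \<epsilon> \<in> signs \<Longrightarrow> vertex A \<epsilon> = {A} \<times> {\<delta> \<in> signs. \<forall>x\<in>ext A. \<epsilon> x = \<delta> x}"
  by (auto simp: signed_set_def sign_rel_def)

lemma vertex_mem: "A \<in> \<L> \<Longrightarrow> \<epsilon> \<in> signs \<Longrightarrow> (A, \<epsilon>) \<in> vertex A \<epsilon>"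
  by (simp add: vertex_eq)

lemma vertex_eq_iff:
  assumes "A \<in> \<L>" "\<epsilon> \<in> signs" "B \<in> \<L>" "\<delta> \<in> signs"
  shows "vertex A \<epsilon> = vertex B \<delta> \<longleftrightarrow> A = B \<and> (\<forall>x\<in>ext A. \<epsilon> x = \<delta> x)"
proof
  assume eq: "vertex A \<epsilon> = vertex B \<delta>"
  have "(A, \<epsilon>) \<in> vertex B \<delta>" using vertex_mem[OF assms(1,2)] eq by simp
  then show "A = B \<and> (\<forall>x\<in>ext A. \<epsilon> x = \<delta> x)" using vertex_eq[OF assms(3,4)] by auto
next
  assume "A = B \<and> (\<forall>x\<in>ext A. \<epsilon> x = \<delta> x)"
  then show "vertex A \<epsilon> = vertex B \<delta>" using assms by (auto simp: vertex_eq)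
qed

section \<open>Decomposition along chains\<close>

text \<open>Barycentric coordinates on the order complex of the nonempty closed sets, without the
  normalisation of the total weight. This leaves room for scaling, for the zero weight, and for
  removing or adding single coefficients.\<close>

definition chain_weight :: "('b set \<Rightarrow> real) \<Rightarrow> bool" where
  "chain_weight c \<longleftrightarrow> (\<forall>A. 0 \<le> c A) \<and> {A. c A \<noteq> 0} \<in> chains (\<L> - {{}})"

definition ext_sum :: "('b set \<Rightarrow> real) \<Rightarrow> 'b \<Rightarrow> real" where
  "ext_sum c x = (\<Sum>A\<in>\<L>. if x \<in> ext A then c A else 0)"

lemma ext_sum_ge:
  assumes "\<And>A. 0 \<le> c A" "A \<in> \<L>" "x \<in> ext A"
  shows "c A \<le> ext_sum c x"
  using member_le_sum[of A \<L> "\<lambda>A. if x \<in> ext A then c A else 0"] assms finite_closed_sets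
  by (auto simp: ext_sum_def)

lemma ext_sum_nonneg: "(\<And>A. 0 \<le> c A) \<Longrightarrow> 0 \<le> ext_sum c x"
  by (auto simp: ext_sum_def intro: sum_nonneg)

lemma ext_sum_nonzero:
  assumes "\<And>A. 0 \<le> c A" "{A. c A \<noteq> 0} \<subseteq> \<L>"
  shows "ext_sum c x \<noteq> 0 \<longleftrightarrow> (\<exists>A. c A \<noteq> 0 \<and> x \<in> ext A)"
proof -
  have "ext_sum c x = 0 \<longleftrightarrow> (\<forall>A\<in>\<L>. (if x \<in> ext A then c A else 0) = 0)"
    unfolding ext_sum_def using assms finite_closed_sets by (intro sum_nonneg_eq_0_iff) auto
  then show ?thesis using assms(2) by auto
qed

lemma chain_weightD:
  assumes "chain_weight c"
  shows "0 \<le> c A" "{A. c A \<noteq> 0} \<subseteq> \<L>" "c A \<noteq> 0 \<Longrightarrow> A \<in> \<L> \<and> A \<noteq> {}"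
    "c A \<noteq> 0 \<Longrightarrow> c B \<noteq> 0 \<Longrightarrow> A \<subseteq> B \<or> B \<subseteq> A"
  using assms by (auto simp: chain_weight_def chains_def chain_subset_def)

text \<open>The support of \<open>ext_sum c\<close> lies between \<open>ext T\<close> and T for the
  largest set T of the chain, so it spans T. The coefficient of T is visible at an extreme point of
  T that no smaller set of the chain contains.\<close>

lemma chain_weight_top:
  assumes c: "chain_weight c" and ne: "c \<noteq> (\<lambda>_. 0)"
  obtains T x where "T \<in> \<L>" "T \<noteq> {}" "c T \<noteq> 0" "cl {x. ext_sum c x \<noteq> 0} = T"
    "x \<in> ext T" "ext_sum c x = c T"
proof -
  have fin: "finite {A. c A \<noteq> 0}"
    using chain_weightD(2)[OF c] finite_closed_sets finite_subset by blast
  have "{A. c A \<noteq> 0} \<noteq> {}" using ne by auto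
  then obtain T where T: "c T \<noteq> 0" and max: "\<And>B. c B \<noteq> 0 \<Longrightarrow> T \<subseteq> B \<Longrightarrow> B = T"
    using finite_has_maximal[OF fin] by auto
  have TL: "T \<in> \<L>" "T \<noteq> {}" using chain_weightD(3)[OF c T] by auto
  have below: "B \<subseteq> T" if "c B \<noteq> 0" for B
    using chain_weightD(4)[OF c T that] max[OF that] by auto
  have supp: "{x. ext_sum c x \<noteq> 0} = (\<Union>A\<in>{A. c A \<noteq> 0}. ext A)"
    using ext_sum_nonzero[of c] chain_weightD[OF c] by auto
  have "ext A \<subseteq> T" if "c A \<noteq> 0" for A
    using below[OF that] ext_subset chain_weightD(3)[OF c that] by blast
  then have sub: "{x. ext_sum c x \<noteq> 0} \<subseteq> T" unfolding supp by auto
  have sup: "ext T \<subseteq> {x. ext_sum c x \<noteq> 0}" unfolding supp using T by auto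
  have "cl {x. ext_sum c x \<noteq> 0} = T"
    using cl_mono[OF sub] cl_mono[OF sup] cl_ext[OF TL(1)] closed_cl[OF TL(1)] closed_subset[OF TL(1)] sub
    by auto
  moreover have "\<exists>x\<in>ext T. ext_sum c x = c T"
  proof -
    have "\<exists>x\<in>ext T. \<forall>B. c B \<noteq> 0 \<and> B \<noteq> T \<longrightarrow> x \<notin> B"
    proof (cases "{B. c B \<noteq> 0 \<and> B \<noteq> T} = {}")
      case True
      then show ?thesis using ext_nonempty[OF TL] by auto
    next
      case False
      then obtain S where S: "c S \<noteq> 0" "S \<noteq> T"
        and Smax: "\<And>B. c B \<noteq> 0 \<Longrightarrow> B \<noteq> T \<Longrightarrow> S \<subseteq> B \<Longrightarrow> B = S"
        using finite_has_maximal[of "{B. c B \<noteq> 0 \<and> B \<noteq> T}"] fin by auto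
      \<comment> \<open>S is the second largest set of the chain. A closed set containing
        \<open>ext T\<close> would contain T, so some extreme point of T avoids S and hence all sets
        below S.\<close>
      have "\<not> ext T \<subseteq> S"
        using closed_subset_if_ext_subset[OF TL(1), of S] chain_weightD(3)[OF c S(1)] below[OF S(1)] S(2)
        by blast
      then obtain x where "x \<in> ext T" "x \<notin> S" by auto
      moreover have "B \<subseteq> S" if "c B \<noteq> 0" "B \<noteq> T" for B
        using chain_weightD(4)[OF c that(1) S(1)] Smax that by blast
      ultimately show ?thesis by blast
    qed
    then obtain x where x: "x \<in> ext T" "\<And>B. c B \<noteq> 0 \<Longrightarrow> B \<noteq> T \<Longrightarrow> x \<notin> B" by auto
    have "ext_sum c x = (\<Sum>A\<in>\<L>. if A = T then c T else 0)"
      unfolding ext_sum_def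
    proof (intro sum.cong refl)
      fix A assume "A \<in> \<L>"
      then show "(if x \<in> ext A then c A else 0) = (if A = T then c T else 0)"
        using x ext_subset by (cases "A = T") auto
    qed
    then show ?thesis using x TL finite_closed_sets by (auto simp: sum.delta)
  qed
  ultimately show ?thesis using that TL T by blast
qed

text \<open>Common parts of the two weights cancel; what is left would have the same top set, with the
  same coefficient.\<close>

lemma chain_weight_unique:
  assumes c: "chain_weight c" and d: "chain_weight d" and eq: "ext_sum c = ext_sum d"
  shows "c = d"
proof (rule ccontr)
  assume "c \<noteq> d"
  \<comment> \<open>Both weights are cleared where they agree and kept where they differ. Any
    coefficient left in either weight is thus a place of disagreement, while the two sums remain
    equal.\<close>
  define c' where "c' = (\<lambda>A. if c A = d A then 0 else c A)"
  define d' where "d' = (\<lambda>A. if c A = d A then 0 else d A)"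
  have c': "chain_weight c'" using c
    by (auto simp: chain_weight_def chains_def chain_subset_def c'_def)
  have d': "chain_weight d'" using d
    by (auto simp: chain_weight_def chains_def chain_subset_def d'_def)
  have eq': "ext_sum c' = ext_sum d'"
  proof
    fix x
    have "ext_sum c' x - ext_sum d' x = ext_sum c x - ext_sum d x"
      unfolding ext_sum_def sum_subtractf[symmetric] by (intro sum.cong) (auto simp: c'_def d'_def)
    then show "ext_sum c' x = ext_sum d' x" using eq by simp
  qed
  have zero: "c' = (\<lambda>_. 0) \<longleftrightarrow> d' = (\<lambda>_. 0)"
  proof -
    have *: "ext_sum a = (\<lambda>_. 0) \<longleftrightarrow> a = (\<lambda>_. 0)" if a: "chain_weight a" for a
    proof
      assume 0: "ext_sum a = (\<lambda>_. 0)"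
      show "a = (\<lambda>_. 0)"
      proof (rule ccontr)
        assume "a \<noteq> (\<lambda>_. 0)"
        from chain_weight_top[OF a this] 0 show False by metis
      qed
    next
      show "ext_sum a = (\<lambda>_. 0)" if "a = (\<lambda>_. 0)" unfolding that by (rule HOL.ext) (simp add: ext_sum_def)
    qed
    show ?thesis using *[OF c'] *[OF d'] eq' by simp
  qed
  have "c' \<noteq> (\<lambda>_. 0)"
  proof
    assume "c' = (\<lambda>_. 0)"
    then have "c' = d'" using zero by simp
    then have "c = d" unfolding c'_def d'_def fun_eq_iff by metis
    then show False using \<open>c \<noteq> d\<close> by simp
  qed
  then have "d' \<noteq> (\<lambda>_. 0)" using zero by simp
  obtain T x where T: "T \<in> \<L>" "T \<noteq> {}" "c' T \<noteq> 0" "cl {x. ext_sum c' x \<noteq> 0} = T" "x \<in> ext T" "ext_sum c' x = c' T"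
    by (rule chain_weight_top[OF c' \<open>c' \<noteq> _\<close>])
  obtain U y where U: "U \<in> \<L>" "U \<noteq> {}" "d' U \<noteq> 0" "cl {x. ext_sum d' x \<noteq> 0} = U" "y \<in> ext U" "ext_sum d' y = d' U"
    by (rule chain_weight_top[OF d' \<open>d' \<noteq> _\<close>])
  have "U = T" using T U eq' by simp
  \<comment> \<open>Each weight attains its top coefficient as the value of the common sum at some
    extreme point of T, and the coefficient of the other weight is at most that value.\<close>
  then have "d' T \<le> c' T" "c' T \<le> d' T"
    using ext_sum_ge[of d' T x] ext_sum_ge[of c' T y] T U eq' chain_weightD(1)[OF c'] chain_weightD(1)[OF d']
    by auto
  then have "c T = d T" using T(3) by (auto simp: c'_def d'_def split: if_splits)
  then show False using T(3) by (simp add: c'_def)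
qed

text \<open>The top set of the chain is the closure of the support, its coefficient the minimum of \<open>u\<close> over
  the extreme points of that set.\<close>

lemma chain_weight_exists:
  assumes "\<And>x. 0 \<le> u x" "{x. u x \<noteq> 0} \<subseteq> E"
  shows "\<exists>c. chain_weight c \<and> ext_sum c = u \<and> (\<forall>A. c A \<noteq> 0 \<longrightarrow> A \<subseteq> cl {x. u x \<noteq> 0})"
  using assms
proof (induction "card {x. u x \<noteq> 0}" arbitrary: u rule: less_induct)
  case less
  let ?S = "{x. u x \<noteq> 0}"
  have finS: "finite ?S" using less.prems finite_ground finite_subset by blast
  show ?case
  proof (cases "?S = {}")
    case True
    then have "u = (\<lambda>_. 0)" by auto
    then show ?thesis
      by (intro exI[of _ "\<lambda>_. 0"]) (auto simp: chain_weight_def chains_def chain_subset_def ext_sum_def)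
  next
    case False
    define A where "A = cl ?S"
    have A: "A \<in> \<L>" using cl_closed less.prems A_def by simp
    have SA: "?S \<subseteq> A" using cl_extensive less.prems A_def by simp
    then have Ane: "A \<noteq> {}" using False by auto
    have extS: "ext A \<subseteq> ?S" using ext_least[OF A SA] A_def by simp
    define m where "m = Min (u ` ext A)"
    have "m \<in> u ` ext A" unfolding m_def using finite_ext[OF A] ext_nonempty[OF A Ane] by auto
    then obtain x where x: "x \<in> ext A" "u x = m" by auto
    have m_le: "m \<le> u y" if "y \<in> ext A" for y unfolding m_def using finite_ext[OF A] that by auto
    have m_pos: "m > 0" using x extS less.prems(1)[of x] by force
    \<comment> \<open>Subtracting the minimum m makes u vanish at x and keeps it nonnegative, so the
      support shrinks strictly and the induction hypothesis applies.\<close>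
    define u' where "u' = (\<lambda>y. if y \<in> ext A then u y - m else u y)"
    let ?S' = "{x. u' x \<noteq> 0}"
    have sub: "?S' \<subset> ?S" using x extS by (auto simp: u'_def)
    have "card ?S' < card ?S" using psubset_card_mono[OF finS sub] .
    moreover have "0 \<le> u' y" for y using less.prems(1) m_le by (auto simp: u'_def)
    moreover have "?S' \<subseteq> E" using sub less.prems(2) by auto
    ultimately obtain c where c: "chain_weight c" "ext_sum c = u'" "\<And>B. c B \<noteq> 0 \<Longrightarrow> B \<subseteq> cl ?S'"
      using less.hyps[of u'] by blast
    have le: "cl ?S' \<subseteq> A" unfolding A_def using cl_mono sub less.prems(2) by auto
    \<comment> \<open>The new support misses the extreme point x of A and cannot span A. By the
      bound on the chain carried through the induction, every set used for u' is then a proper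
      subset of A, and A can be put on top.\<close>
    have "cl ?S' \<noteq> A"
    proof
      assume "cl ?S' = A"
      moreover have "?S' \<subseteq> A" using sub SA by blast
      ultimately have "x \<in> ?S'" using ext_least[OF A, of ?S'] x(1) by blast
      then show False using x by (simp add: u'_def)
    qed
    have cA: "c A = 0" using c(3)[of A] le \<open>cl ?S' \<noteq> A\<close> by blast
    have "chain_weight (c(A := m))"
      unfolding chain_weight_def
    proof (intro conjI allI)
      show "0 \<le> (c(A := m)) B" for B using chain_weightD(1)[OF c(1)] m_pos by auto
      have "B \<subseteq> C \<or> C \<subseteq> B" if "B = A \<or> c B \<noteq> 0" "C = A \<or> c C \<noteq> 0" for B C
        using that chain_weightD(4)[OF c(1)] c(3) le by blast
      moreover have "{B. (c(A := m)) B \<noteq> 0} \<subseteq> \<L> - {{}}"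
        using chain_weightD(3)[OF c(1)] A Ane by (auto split: if_splits)
      ultimately show "{B. (c(A := m)) B \<noteq> 0} \<in> chains (\<L> - {{}})"
        unfolding chains_def chain_subset_def by (auto split: if_splits)
    qed
    moreover have "ext_sum (c(A := m)) = u"
    proof
      fix y
      have "ext_sum (c(A := m)) y = (\<Sum>B\<in>\<L>. (if y \<in> ext B then c B else 0)
          + (if B = A then if y \<in> ext A then m else 0 else 0))"
        unfolding ext_sum_def by (intro sum.cong) (auto simp: cA)
      also have "\<dots> = u' y + (if y \<in> ext A then m else 0)"
        using A finite_closed_sets c(2) by (simp add: sum.distrib ext_sum_def[symmetric])
      finally show "ext_sum (c(A := m)) y = u y" by (simp add: u'_def)
    qed
    moreover have "\<forall>B. (c(A := m)) B \<noteq> 0 \<longrightarrow> B \<subseteq> cl ?S"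
      using c(3) le unfolding A_def by auto
    ultimately show ?thesis by blast
  qed
qed

end

section \<open>Realizations\<close>

lemma Hausdorff_euclidean_fun: "Hausdorff_space (top_of_set (S :: ('v \<Rightarrow> real) set))"
proof -
  have "Hausdorff_space (euclidean :: ('v \<Rightarrow> real) topology)"
    unfolding euclidean_product_topology[symmetric] by (simp add: Hausdorff_space_product_topology)
  then show ?thesis by (rule Hausdorff_space_subtopology)
qed

text \<open>Tychonoff for a product of copies of [-1,1] and {0}. Simplices and unit balls are closed
  subsets of such a product.\<close>

lemma compact_cube: "compact {t :: 'v \<Rightarrow> real. \<forall>v. if v \<in> S then \<bar>t v\<bar> \<le> 1 else t v = 0}"
proof -
  have "compactin (product_topology (\<lambda>_. euclidean) UNIV)
      (\<Pi>\<^sub>E v\<in>(UNIV :: 'v set). if v \<in> S then {-1..1::real} else {0})"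
    unfolding compactin_PiE by auto
  then have "compact (\<Pi>\<^sub>E v\<in>(UNIV :: 'v set). if v \<in> S then {-1..1::real} else {0})"
    by (simp add: euclidean_product_topology)
  also have "(\<Pi>\<^sub>E v\<in>(UNIV :: 'v set). if v \<in> S then {-1..1::real} else {0}) =
      {t. \<forall>v. if v \<in> S then \<bar>t v\<bar> \<le> 1 else t v = 0}"
    by (rule set_eqI) (simp add: PiE_UNIV_domain Pi_iff abs_le_iff, smt (verit) atLeastAtMost_iff singletonD singletonI)
  finally show ?thesis .
qed

lemma geom_simplex_le_1:
  assumes "finite \<sigma>" "t \<in> geom_simplex \<sigma>"
  shows "t v \<le> 1"
proof (cases "v \<in> \<sigma>")
  case True
  then have "t v \<le> (\<Sum>v\<in>\<sigma>. t v)" using assms by (intro member_le_sum) (auto simp: geom_simplex_def)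
  then show ?thesis using assms by (simp add: geom_simplex_def)
qed (use assms in \<open>simp add: geom_simplex_def\<close>)

lemma compact_geom_simplex:
  assumes "finite \<sigma>"
  shows "compact (geom_simplex \<sigma>)"
proof -
  have eq: "geom_simplex \<sigma> = {t. \<forall>v. if v \<in> \<sigma> then \<bar>t v\<bar> \<le> 1 else t v = 0} \<inter>
      ((\<Inter>v. {t. 0 \<le> t v}) \<inter> {t. (\<Sum>v\<in>\<sigma>. t v) = 1})"
    using geom_simplex_le_1[OF assms] by (auto simp: geom_simplex_def)
  have cl: "closed ((\<Inter>v. {t :: 'a \<Rightarrow> real. 0 \<le> t v}) \<inter> {t. (\<Sum>v\<in>\<sigma>. t v) = 1})"
    by (intro closed_Int closed_INT ballI closed_Collect_le closed_Collect_eq continuous_intros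
        continuous_on_product_coordinates)
  show ?thesis unfolding eq by (rule compact_Int_closed[OF compact_cube cl])
qed

lemma geom_simplex_mono:
  assumes "\<sigma> \<subseteq> \<tau>" "finite \<tau>"
  shows "geom_simplex \<sigma> \<subseteq> geom_simplex \<tau>"
proof
  fix t assume t: "t \<in> geom_simplex \<sigma>"
  then have "(\<Sum>v\<in>\<tau>. t v) = (\<Sum>v\<in>\<sigma>. t v)"
    using assms by (intro sum.mono_neutral_right) (auto simp: geom_simplex_def)
  then show "t \<in> geom_simplex \<tau>" using t assms by (auto simp: geom_simplex_def)
qed

text \<open>Each face extends to a maximal face, whose simplex contains the smaller one. Membership
  in a star can therefore be shown with any face through v.\<close>

lemma geom_star_eq:
  assumes "finite K" "\<And>\<sigma>. \<sigma> \<in> K \<Longrightarrow> finite \<sigma>"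
  shows "geom_star K v = (\<Union>\<sigma>\<in>{\<sigma> \<in> K. v \<in> \<sigma>}. geom_simplex \<sigma>)"
proof
  show "geom_star K v \<subseteq> (\<Union>\<sigma>\<in>{\<sigma> \<in> K. v \<in> \<sigma>}. geom_simplex \<sigma>)"
    by (auto simp: geom_star_def maximal_faces_def)
  show "(\<Union>\<sigma>\<in>{\<sigma> \<in> K. v \<in> \<sigma>}. geom_simplex \<sigma>) \<subseteq> geom_star K v"
  proof clarify
    fix t \<sigma> assume t: "t \<in> geom_simplex \<sigma>" "\<sigma> \<in> K" "v \<in> \<sigma>"
    obtain \<tau> where \<tau>: "\<tau> \<in> K" "\<sigma> \<subseteq> \<tau>" "\<forall>\<rho>\<in>K. \<tau> \<subseteq> \<rho> \<longrightarrow> \<tau> = \<rho>"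
      using finite_has_maximal2[OF assms(1) t(2)] by auto
    then have "\<tau> \<in> maximal_faces K" "v \<in> \<tau>" using t by (auto simp: maximal_faces_def)
    moreover have "t \<in> geom_simplex \<tau>" using geom_simplex_mono[OF \<tau>(2)] assms(2) \<tau>(1) t(1) by blast
    ultimately show "t \<in> geom_star K v" by (auto simp: geom_star_def)
  qed
qed

context convex_closure
begin

text \<open>For a sign vector \<epsilon> the sum has at most one nonzero term, because the class
  \<open>vertex A \<epsilon>\<close> determines A. This evaluates the coefficient at X without
  choosing a representative of X.\<close>

definition lift_weight :: "('b set \<Rightarrow> real) \<Rightarrow> ('b \<Rightarrow> int) \<Rightarrow> 'b signed \<Rightarrow> real" where
  "lift_weight c \<epsilon> X = (\<Sum>A\<in>\<L>. if X = vertex A \<epsilon> then c A else 0)"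

abbreviation "R \<equiv> realization (pm_Delta E cl)"

lemma lift_weight_vertex:
  assumes "A \<in> \<L>" "\<epsilon> \<in> signs"
  shows "lift_weight c \<epsilon> (vertex A \<epsilon>) = c A"
proof -
  have "lift_weight c \<epsilon> (vertex A \<epsilon>) = (\<Sum>B\<in>\<L>. if B = A then c B else 0)"
    unfolding lift_weight_def using assms vertex_eq_iff by (intro sum.cong) auto
  then show ?thesis using assms finite_closed_sets by (simp add: sum.delta)
qed

lemma lift_weight_zero:
  assumes "X \<notin> (\<lambda>A. vertex A \<epsilon>) ` {A \<in> \<L>. c A \<noteq> 0}"
  shows "lift_weight c \<epsilon> X = 0"
  unfolding lift_weight_def using assms by (intro sum.neutral) auto

lemma inj_on_vertex: "\<epsilon> \<in> signs \<Longrightarrow> inj_on (\<lambda>A. vertex A \<epsilon>) \<L>"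
  using vertex_eq_iff by (auto intro!: inj_onI)

lemma lift_weight_in_simplex:
  assumes c: "chain_weight c" and "{A. c A \<noteq> 0} \<subseteq> \<sigma>" "\<sigma> \<subseteq> \<L>" "\<epsilon> \<in> signs" "(\<Sum>A\<in>\<L>. c A) = 1"
  shows "lift_weight c \<epsilon> \<in> geom_simplex ((\<lambda>A. vertex A \<epsilon>) ` \<sigma>)"
proof -
  have "(\<Sum>X\<in>(\<lambda>A. vertex A \<epsilon>) ` \<sigma>. lift_weight c \<epsilon> X) = (\<Sum>A\<in>\<sigma>. lift_weight c \<epsilon> (vertex A \<epsilon>))"
    using inj_on_subset[OF inj_on_vertex[OF assms(4)] assms(3)] by (simp add: sum.reindex)
  also have "\<dots> = (\<Sum>A\<in>\<sigma>. c A)"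
    using assms by (intro sum.cong) (auto simp: lift_weight_vertex)
  also have "\<dots> = (\<Sum>A\<in>\<L>. c A)"
    using assms finite_closed_sets by (intro sum.mono_neutral_left) auto
  finally have "(\<Sum>X\<in>(\<lambda>A. vertex A \<epsilon>) ` \<sigma>. lift_weight c \<epsilon> X) = 1" using assms by simp
  moreover have "0 \<le> lift_weight c \<epsilon> X" for X
    using chain_weightD(1)[OF c] by (auto simp: lift_weight_def intro!: sum_nonneg)
  moreover have "lift_weight c \<epsilon> X = 0" if "X \<notin> (\<lambda>A. vertex A \<epsilon>) ` \<sigma>" for X
    using that assms(2) by (intro lift_weight_zero) auto
  ultimately show ?thesis by (auto simp: geom_simplex_def)
qed

lemma simplex_lift_weight:
  assumes \<sigma>: "\<sigma> \<in> chains (\<L> - {{}})" and \<epsilon>: "\<epsilon> \<in> signs"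
    and t: "t \<in> geom_simplex ((\<lambda>A. vertex A \<epsilon>) ` \<sigma>)"
  obtains c where "chain_weight c" "{A. c A \<noteq> 0} \<subseteq> \<sigma>" "(\<Sum>A\<in>\<L>. c A) = 1" "t = lift_weight c \<epsilon>"
proof -
  define c where "c = (\<lambda>A. if A \<in> \<sigma> then t (vertex A \<epsilon>) else 0)"
  have \<sigma>L: "\<sigma> \<subseteq> \<L>" using \<sigma> by (auto simp: chains_def)
  have sub: "{A. c A \<noteq> 0} \<subseteq> \<sigma>" by (auto simp: c_def)
  have "{A. c A \<noteq> 0} \<in> chains (\<L> - {{}})"
    using \<sigma> by (auto simp: chains_def chain_subset_def c_def)
  moreover have "0 \<le> c A" for A using t by (auto simp: c_def geom_simplex_def)
  ultimately have cw: "chain_weight c" by (auto simp: chain_weight_def)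
  have "(\<Sum>A\<in>\<L>. c A) = (\<Sum>A\<in>\<sigma>. c A)"
    using sub \<sigma>L finite_closed_sets by (intro sum.mono_neutral_right) auto
  also have "\<dots> = (\<Sum>A\<in>\<sigma>. t (vertex A \<epsilon>))" by (simp add: c_def)
  also have "\<dots> = (\<Sum>X\<in>(\<lambda>A. vertex A \<epsilon>) ` \<sigma>. t X)"
    using inj_on_subset[OF inj_on_vertex[OF \<epsilon>] \<sigma>L] by (simp add: sum.reindex)
  finally have sum: "(\<Sum>A\<in>\<L>. c A) = 1" using t by (simp add: geom_simplex_def)
  have "t = lift_weight c \<epsilon>"
  proof
    fix X
    show "t X = lift_weight c \<epsilon> X"
    proof (cases "X \<in> (\<lambda>A. vertex A \<epsilon>) ` \<sigma>")
      case True
      then obtain A where "A \<in> \<sigma>" "X = vertex A \<epsilon>" by auto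
      then show ?thesis using \<sigma>L \<epsilon> by (auto simp: lift_weight_vertex c_def)
    next
      case False
      then have "t X = 0" using t by (auto simp: geom_simplex_def)
      moreover have "lift_weight c \<epsilon> X = 0" using False sub by (intro lift_weight_zero) auto
      ultimately show ?thesis by simp
    qed
  qed
  with cw sub sum show ?thesis by (rule that)
qed

lemma finite_subset_closed: "\<sigma> \<subseteq> \<L> \<Longrightarrow> finite \<sigma>"
  using finite_closed_sets finite_subset by blast

lemma order_complex_closed: "P \<subseteq> \<L> \<Longrightarrow> order_complex P = chains P"
  unfolding order_complex_def chains_def using finite_subset_closed by blast

text \<open>From here on a point of the realization is handled as a pair of a normalised chain
  weight and one sign vector. The sign vector is determined only on the extreme points of the sets
  with nonzero weight.\<close>

lemma realization_eq:
  "R = {lift_weight c \<epsilon> | c \<epsilon>. chain_weight c \<and> (\<Sum>A\<in>\<L>. c A) = 1 \<and> \<epsilon> \<in> signs}"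
proof (intro set_eqI iffI)
  fix t assume "t \<in> R"
  then obtain \<sigma> \<epsilon> where "\<sigma> \<in> chains (\<L> - {{}})" "\<epsilon> \<in> signs" "t \<in> geom_simplex ((\<lambda>A. vertex A \<epsilon>) ` \<sigma>)"
    unfolding realization_def pm_Delta_def pm_complex_def
    using order_complex_closed[of "\<L> - {{}}"] by auto
  then obtain c where "chain_weight c" "{A. c A \<noteq> 0} \<subseteq> \<sigma>" "(\<Sum>A\<in>\<L>. c A) = 1" "t = lift_weight c \<epsilon>"
    by (rule simplex_lift_weight)
  then show "t \<in> {lift_weight c \<epsilon> | c \<epsilon>. chain_weight c \<and> (\<Sum>A\<in>\<L>. c A) = 1 \<and> \<epsilon> \<in> signs}"
    using \<open>\<epsilon> \<in> signs\<close> by blast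
next
  fix t assume "t \<in> {lift_weight c \<epsilon> | c \<epsilon>. chain_weight c \<and> (\<Sum>A\<in>\<L>. c A) = 1 \<and> \<epsilon> \<in> signs}"
  then obtain c \<epsilon> where t: "t = lift_weight c \<epsilon>" "chain_weight c" "(\<Sum>A\<in>\<L>. c A) = 1" "\<epsilon> \<in> signs" by auto
  let ?\<sigma> = "{A. c A \<noteq> 0}"
  have "?\<sigma> \<in> chains (\<L> - {{}})" using t by (simp add: chain_weight_def)
  moreover have "t \<in> geom_simplex ((\<lambda>A. vertex A \<epsilon>) ` ?\<sigma>)"
    using lift_weight_in_simplex[OF t(2), of ?\<sigma>] chain_weightD(2) t by auto
  ultimately show "t \<in> R"
    unfolding realization_def pm_Delta_def pm_complex_def
    using order_complex_closed[of "\<L> - {{}}"] t(4) by blast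
qed

lemma finite_pm_complex:
  assumes "P \<subseteq> \<L>"
  shows "finite (pm_complex E cl (order_complex P))" "\<And>\<sigma>. \<sigma> \<in> pm_complex E cl (order_complex P) \<Longrightarrow> finite \<sigma>"
proof -
  have "pm_complex E cl (order_complex P) \<subseteq> (\<lambda>(\<sigma>, \<epsilon>). (\<lambda>A. vertex A \<epsilon>) ` \<sigma>) ` (Pow \<L> \<times> signs)"
    using assms by (auto simp: pm_complex_def order_complex_def chains_def)
  then show "finite (pm_complex E cl (order_complex P))"
    using finite_closed_sets finite_signs by (meson finite_Pow_iff finite_SigmaI finite_imageI finite_subset)
  show "\<And>\<sigma>. \<sigma> \<in> pm_complex E cl (order_complex P) \<Longrightarrow> finite \<sigma>"
    by (auto simp: pm_complex_def order_complex_def)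
qed

lemma compact_realization: "compact R"
  unfolding realization_def pm_Delta_def
  using finite_pm_complex[of "\<L> - {{}}"] by (intro compact_UN compact_geom_simplex) auto

section \<open>The piecewise linear map to the space of the ground set\<close>

text \<open>All representatives of a class agree on the extreme points of its closed set, so the
  value does not depend on the one chosen.\<close>

definition signed_indicator :: "'b signed \<Rightarrow> 'b \<Rightarrow> real" where
  "signed_indicator X x =
     (let (A, \<epsilon>) = (SOME p. p \<in> X) in if x \<in> ext A then of_int (\<epsilon> x) else 0)"

definition vertices :: "'b signed set" where
  "vertices = (\<lambda>(A, \<epsilon>). vertex A \<epsilon>) ` (\<L> \<times> signs)"

text \<open>The linear extension of the vertex map. Summing over all vertices instead of the face
  carrying t gives one formula on the whole function space, which makes continuity
  immediate.\<close>

definition signed_sum :: "('b signed \<Rightarrow> real) \<Rightarrow> 'b \<Rightarrow> real" where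
  "signed_sum t x = (\<Sum>X\<in>vertices. t X * signed_indicator X x)"

lemma finite_vertices: "finite vertices"
  using finite_closed_sets finite_signs by (simp add: vertices_def)

lemma signed_indicator_vertex:
  assumes "A \<in> \<L>" "\<epsilon> \<in> signs"
  shows "signed_indicator (vertex A \<epsilon>) x = (if x \<in> ext A then of_int (\<epsilon> x) else 0)"
proof -
  obtain B \<delta> where p: "(SOME p. p \<in> vertex A \<epsilon>) = (B, \<delta>)" by (cases "SOME p. p \<in> vertex A \<epsilon>")
  have "(B, \<delta>) \<in> vertex A \<epsilon>" using someI[of "\<lambda>p. p \<in> vertex A \<epsilon>", OF vertex_mem[OF assms]] p by simp
  then have "B = A" "\<forall>x\<in>ext A. \<epsilon> x = \<delta> x" using vertex_eq[OF assms] by auto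
  then show ?thesis by (simp add: signed_indicator_def p)
qed

text \<open>The vertices of a face share \<epsilon>, so all contributions at x have the same sign
  and nothing cancels.\<close>

lemma signed_sum_lift_weight:
  assumes "\<epsilon> \<in> signs"
  shows "signed_sum (lift_weight c \<epsilon>) x = of_int (\<epsilon> x) * ext_sum c x"
proof -
  have "signed_sum (lift_weight c \<epsilon>) x =
      (\<Sum>X\<in>(\<lambda>A. vertex A \<epsilon>) ` \<L>. lift_weight c \<epsilon> X * signed_indicator X x)"
    unfolding signed_sum_def using assms finite_vertices
    by (intro sum.mono_neutral_right) (auto simp: vertices_def intro!: lift_weight_zero)
  also have "\<dots> = (\<Sum>A\<in>\<L>. c A * (if x \<in> ext A then of_int (\<epsilon> x) else 0))"
    using inj_on_vertex[OF assms] assms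
    by (simp add: sum.reindex lift_weight_vertex signed_indicator_vertex)
  also have "\<dots> = of_int (\<epsilon> x) * ext_sum c x"
    unfolding ext_sum_def sum_distrib_left by (intro sum.cong) auto
  finally show ?thesis .
qed

lemma continuous_on_signed_sum: "continuous_on S signed_sum"
  unfolding signed_sum_def
  by (intro continuous_on_coordinatewise_then_product continuous_intros
      continuous_on_product_then_coordinatewise[OF continuous_on_id])

lemma ext_sum_outside:
  assumes "x \<notin> E"
  shows "ext_sum c x = 0"
  unfolding ext_sum_def
proof (intro sum.neutral ballI)
  show "(if x \<in> ext A then c A else 0) = 0" if "A \<in> \<L>" for A
    using ext_ground[OF that] assms by auto
qed

lemma signed_sum_support: "t \<in> R \<Longrightarrow> x \<notin> E \<Longrightarrow> signed_sum t x = 0"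
  unfolding realization_eq by (auto simp: signed_sum_lift_weight ext_sum_outside)

lemma abs_signed_sum_lift_weight:
  assumes "\<epsilon> \<in> signs" "chain_weight c"
  shows "\<bar>signed_sum (lift_weight c \<epsilon>) x\<bar> = ext_sum c x"
proof (cases "x \<in> E")
  case True
  then show ?thesis
    using signs_cases[OF assms(1) True] ext_sum_nonneg[of c x] chain_weightD(1)[OF assms(2)]
    by (auto simp: signed_sum_lift_weight[OF assms(1)] abs_mult)
next
  case False
  then show ?thesis by (simp add: ext_sum_outside signed_sum_lift_weight[OF assms(1)])
qed

lemma ext_sum_zero: "ext_sum (\<lambda>_. 0) = (\<lambda>_. 0)"
  by (rule HOL.ext) (simp add: ext_sum_def)

lemma signed_sum_nonzero:
  assumes "t \<in> R"
  shows "\<exists>x. signed_sum t x \<noteq> 0"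
proof -
  obtain c \<epsilon> where c: "t = lift_weight c \<epsilon>" "chain_weight c" "(\<Sum>A\<in>\<L>. c A) = 1" "\<epsilon> \<in> signs"
    using assms unfolding realization_eq by auto
  have "c \<noteq> (\<lambda>_. 0)" using c(3) by auto
  moreover have "chain_weight (\<lambda>_. 0)" by (simp add: chain_weight_def chains_def chain_subset_def)
  ultimately have "ext_sum c \<noteq> (\<lambda>_. 0)" using chain_weight_unique[OF c(2)] ext_sum_zero by metis
  then obtain x where "ext_sum c x \<noteq> 0" by auto
  then have "signed_sum t x \<noteq> 0" using abs_signed_sum_lift_weight[OF c(4,2), of x] c(1) by auto
  then show ?thesis by blast
qed

lemma chain_weight_scale:
  assumes "chain_weight c" "0 < s"
  shows "chain_weight (\<lambda>A. s * c A)" "ext_sum (\<lambda>A. s * c A) x = s * ext_sum c x"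
proof -
  show "chain_weight (\<lambda>A. s * c A)" using assms by (simp add: chain_weight_def)
  show "ext_sum (\<lambda>A. s * c A) x = s * ext_sum c x"
    unfolding ext_sum_def sum_distrib_left by (intro sum.cong) auto
qed

lemma signs_iff: "\<epsilon> \<in> signs \<longleftrightarrow> (\<forall>x\<in>E. \<epsilon> x = 1 \<or> \<epsilon> x = -1) \<and> (\<forall>x. x \<notin> E \<longrightarrow> \<epsilon> x = undefined)"
  by (auto simp: sign_vectors_def PiE_iff extensional_def)

text \<open>Absolute values turn the hypothesis into an equation between sums of chain weights, and
  uniqueness gives c = s * d. Comparing total weights yields s = 1. The signs are then recovered at
  the extreme points of every set with nonzero weight, where the sum does not vanish; these signs
  determine the vertices.\<close>

lemma signed_sum_inj_ray:
  assumes t: "t \<in> R" and t': "t' \<in> R" and s: "0 < s" and eq: "\<And>x. signed_sum t x = s * signed_sum t' x"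
  shows "t = t'"
proof -
  obtain c \<epsilon> where c: "t = lift_weight c \<epsilon>" "chain_weight c" "(\<Sum>A\<in>\<L>. c A) = 1" "\<epsilon> \<in> signs"
    using t unfolding realization_eq by auto
  obtain d \<delta> where d: "t' = lift_weight d \<delta>" "chain_weight d" "(\<Sum>A\<in>\<L>. d A) = 1" "\<delta> \<in> signs"
    using t' unfolding realization_eq by auto
  have "ext_sum c x = s * ext_sum d x" for x
    using abs_signed_sum_lift_weight[OF c(4,2), of x] abs_signed_sum_lift_weight[OF d(4,2), of x] c d s eq[of x]
    by (simp add: abs_mult)
  then have "ext_sum c = ext_sum (\<lambda>A. s * d A)"
    using chain_weight_scale(2)[OF d(2) s] by (intro HOL.ext) simp
  then have cd: "c = (\<lambda>A. s * d A)"
    using chain_weight_unique[OF c(2) chain_weight_scale(1)[OF d(2) s]] by simp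
  then have "(\<Sum>A\<in>\<L>. c A) = s * (\<Sum>A\<in>\<L>. d A)" by (simp add: sum_distrib_left)
  then have s1: "s = 1" using c(3) d(3) by simp
  then have cd: "c = d" using cd by simp
  have sign_eq: "\<epsilon> x = \<delta> x" if A: "c A \<noteq> 0" "x \<in> ext A" for A x
  proof -
    have "ext_sum c x \<noteq> 0"
      using ext_sum_nonzero[of c x] chain_weightD[OF c(2)] that by blast
    moreover have "of_int (\<epsilon> x) * ext_sum c x = of_int (\<delta> x) * ext_sum c x"
      using eq[of x] c d cd s1 by (simp add: signed_sum_lift_weight)
    ultimately show ?thesis by simp
  qed
  have "lift_weight c \<epsilon> X = lift_weight c \<delta> X" for X
    unfolding lift_weight_def
  proof (intro sum.cong refl)
    fix A assume A: "A \<in> \<L>"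
    show "(if X = vertex A \<epsilon> then c A else 0) = (if X = vertex A \<delta> then c A else 0)"
    proof (cases "c A = 0")
      case False
      then have "vertex A \<epsilon> = vertex A \<delta>" using vertex_eq_iff[OF A c(4) A d(4)] sign_eq by auto
      then show ?thesis by simp
    qed simp
  qed
  then show ?thesis using c(1) d(1) cd by auto
qed

text \<open>The value 1 at zeros of v is a default that keeps the result a sign vector.\<close>

definition sign_of :: "('b \<Rightarrow> real) \<Rightarrow> 'b \<Rightarrow> int" where
  "sign_of v = (\<lambda>x\<in>E. if v x < 0 then -1 else 1)"

lemma sign_of_signs: "sign_of v \<in> signs"
  by (auto simp: sign_of_def sign_vectors_def)

lemma sign_of_mult_abs: "x \<in> E \<Longrightarrow> of_int (sign_of v x) * \<bar>v x\<bar> = v x"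
  by (simp add: sign_of_def)

lemma sign_of_mult: "x \<in> E \<Longrightarrow> of_int (sign_of v x) * v x = \<bar>v x\<bar>"
  by (simp add: sign_of_def)

text \<open>Decompose the absolute value of v along a chain, divide by the total weight, and attach
  the signs of v.\<close>

lemma signed_sum_surj_ray:
  assumes supp: "{x. v x \<noteq> 0} \<subseteq> E" and "v \<noteq> (\<lambda>_. 0)"
  obtains t s where "t \<in> R" "0 < s" "signed_sum t = (\<lambda>x. s * v x)"
proof -
  have "{x. \<bar>v x\<bar> \<noteq> 0} \<subseteq> E" using supp by auto
  then obtain c where c: "chain_weight c" "ext_sum c = (\<lambda>x. \<bar>v x\<bar>)"
    using chain_weight_exists[of "\<lambda>x. \<bar>v x\<bar>"] by auto
  have "c \<noteq> (\<lambda>_. 0)"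
  proof
    assume "c = (\<lambda>_. 0)"
    then have "ext_sum c = (\<lambda>_. 0)" using ext_sum_zero by simp
    then have "\<bar>v x\<bar> = 0" for x using c(2) by metis
    then show False using assms(2) by auto
  qed
  then obtain A where A: "c A \<noteq> 0" by auto
  define s where "s = 1 / (\<Sum>A\<in>\<L>. c A)"
  have pos: "0 < (\<Sum>A\<in>\<L>. c A)"
    using A chain_weightD[OF c(1)] finite_closed_sets by (intro sum_pos2[of _ A]) (auto simp: less_le)
  have s: "0 < s" using pos by (simp add: s_def)
  define t where "t = lift_weight (\<lambda>A. s * c A) (sign_of v)"
  have "(\<Sum>A\<in>\<L>. s * c A) = 1" using pos by (simp add: s_def sum_divide_distrib[symmetric])
  then have "t \<in> R"
    unfolding realization_eq t_def using chain_weight_scale(1)[OF c(1) s] sign_of_signs by blast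
  moreover have "signed_sum t x = s * v x" for x
  proof (cases "x \<in> E")
    case True
    then show ?thesis unfolding t_def signed_sum_lift_weight[OF sign_of_signs] chain_weight_scale(2)[OF c(1) s] c(2)
      using sign_of_mult_abs[OF True, of v] by (simp add: algebra_simps)
  next
    case False
    then have "v x = 0" using supp by auto
    then show ?thesis unfolding t_def signed_sum_lift_weight[OF sign_of_signs] chain_weight_scale(2)[OF c(1) s] c(2)
      by simp
  qed
  ultimately show ?thesis using that[of t s] s by (simp add: fun_eq_iff)
qed

section \<open>Cells as preimages of cones\<close>

text \<open>A product of an orthant in the coordinates of \<open>ext A\<close> with the full
  coordinate space of the other points of A; \<open>open_cone\<close> is its relative
  interior.\<close>

definition cone :: "'b set \<Rightarrow> ('b \<Rightarrow> int) \<Rightarrow> ('b \<Rightarrow> real) set" where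
  "cone A \<epsilon> = {v. (\<forall>x. x \<notin> A \<longrightarrow> v x = 0) \<and> (\<forall>x\<in>ext A. 0 \<le> of_int (\<epsilon> x) * v x)}"

definition open_cone :: "'b set \<Rightarrow> ('b \<Rightarrow> int) \<Rightarrow> ('b \<Rightarrow> real) set" where
  "open_cone A \<epsilon> = {v. (\<forall>x. x \<notin> A \<longrightarrow> v x = 0) \<and> (\<forall>x\<in>ext A. 0 < of_int (\<epsilon> x) * v x)}"

lemma cone_scale:
  assumes "0 < s"
  shows "(\<lambda>x. s * v x) \<in> cone A \<epsilon> \<longleftrightarrow> v \<in> cone A \<epsilon>"
    and "(\<lambda>x. s * v x) \<in> open_cone A \<epsilon> \<longleftrightarrow> v \<in> open_cone A \<epsilon>"
proof -
  have le: "0 \<le> of_int e * (s * y) \<longleftrightarrow> 0 \<le> of_int e * y" for e :: int and y :: real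
    using mult_le_cancel_left_pos[OF assms, of 0 "of_int e * y"] by (simp only: mult_zero_right mult.left_commute)
  have less: "0 < of_int e * (s * y) \<longleftrightarrow> 0 < of_int e * y" for e :: int and y :: real
    using mult_less_cancel_left_pos[OF assms, of 0 "of_int e * y"] by (simp only: mult_zero_right mult.left_commute)
  show "(\<lambda>x. s * v x) \<in> cone A \<epsilon> \<longleftrightarrow> v \<in> cone A \<epsilon>"
    unfolding cone_def mem_Collect_eq le using assms by simp
  show "(\<lambda>x. s * v x) \<in> open_cone A \<epsilon> \<longleftrightarrow> v \<in> open_cone A \<epsilon>"
    unfolding open_cone_def mem_Collect_eq less using assms by simp
qed

lemma mem_cell_iff_simplex:
  assumes "A \<in> \<L>"
  shows "t \<in> cell E cl A \<epsilon> \<longleftrightarrow> (\<exists>\<sigma> \<delta>. \<sigma> \<in> chains ({B \<in> \<L>. B \<subseteq> A} - {{}}) \<and> \<delta> \<in> signs \<and>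
    vertex A \<epsilon> \<in> (\<lambda>B. vertex B \<delta>) ` \<sigma> \<and> t \<in> geom_simplex ((\<lambda>B. vertex B \<delta>) ` \<sigma>))"
proof -
  have P: "{B \<in> \<L>. B \<subseteq> A} - {{}} \<subseteq> \<L>" by auto
  have "cell E cl A \<epsilon> = (\<Union>\<sigma>\<in>{\<sigma> \<in> pm_Delta_below E cl A. vertex A \<epsilon> \<in> \<sigma>}. geom_simplex \<sigma>)"
    unfolding cell_def
    by (rule geom_star_eq) (use finite_pm_complex[OF P] in \<open>auto simp: pm_Delta_below_def\<close>)
  then have "t \<in> cell E cl A \<epsilon> \<longleftrightarrow> (\<exists>\<tau>. \<tau> \<in> pm_Delta_below E cl A \<and> vertex A \<epsilon> \<in> \<tau> \<and> t \<in> geom_simplex \<tau>)"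
    by auto
  moreover have "\<tau> \<in> pm_Delta_below E cl A \<longleftrightarrow> (\<exists>\<sigma> \<delta>. \<tau> = (\<lambda>B. vertex B \<delta>) ` \<sigma> \<and>
      \<sigma> \<in> chains ({B \<in> \<L>. B \<subseteq> A} - {{}}) \<and> \<delta> \<in> signs)" for \<tau>
    unfolding pm_Delta_below_def pm_complex_def order_complex_closed[OF P] mem_Collect_eq by (rule refl)
  ultimately show ?thesis by auto
qed

text \<open>A face of the star uses sets below A and signs agreeing with \<epsilon> on
  \<open>ext A\<close>, which gives the cone conditions. Conversely, these conditions allow the
  carrier of t to be extended by the vertex (A,\<epsilon>): its sets lie in A, and its signs can
  conflict with \<epsilon> on \<open>ext A\<close> only where t has coordinate zero.\<close>

lemma mem_cell_iff:
  assumes A: "A \<in> \<L>" "A \<noteq> {}" and \<epsilon>: "\<epsilon> \<in> signs"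
  shows "t \<in> cell E cl A \<epsilon> \<longleftrightarrow> t \<in> R \<and> signed_sum t \<in> cone A \<epsilon>"
proof
  assume "t \<in> cell E cl A \<epsilon>"
  then obtain \<sigma> \<delta> where \<sigma>: "\<sigma> \<in> chains ({B \<in> \<L>. B \<subseteq> A} - {{}})" "\<delta> \<in> signs"
    "vertex A \<epsilon> \<in> (\<lambda>B. vertex B \<delta>) ` \<sigma>" "t \<in> geom_simplex ((\<lambda>B. vertex B \<delta>) ` \<sigma>)"
    unfolding mem_cell_iff_simplex[OF A(1)] by auto
  have \<sigma>': "\<sigma> \<in> chains (\<L> - {{}})" using \<sigma>(1) by (auto simp: chains_def)
  obtain c where c: "chain_weight c" "{B. c B \<noteq> 0} \<subseteq> \<sigma>" "(\<Sum>B\<in>\<L>. c B) = 1" "t = lift_weight c \<delta>"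
    using \<sigma>' \<sigma>(2,4) by (rule simplex_lift_weight)
  have below: "B \<in> \<L> \<and> B \<subseteq> A" if "B \<in> \<sigma>" for B using that \<sigma>(1) by (auto simp: chains_def)
  obtain B where B: "B \<in> \<sigma>" "vertex A \<epsilon> = vertex B \<delta>" using \<sigma>(3) by auto
  then have agree: "\<forall>x\<in>ext A. \<epsilon> x = \<delta> x"
    using below[OF B(1)] vertex_eq_iff[of A \<epsilon> B \<delta>] A \<epsilon> \<sigma>(2) by blast
  have "signed_sum t x = 0" if "x \<notin> A" for x
  proof -
    have "ext_sum c x = 0"
      using ext_sum_nonzero[of c x] chain_weightD[OF c(1)] c(2) below ext_subset that by blast
    then show ?thesis unfolding c(4) by (simp add: signed_sum_lift_weight[OF \<sigma>(2)])
  qed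
  moreover have "0 \<le> of_int (\<epsilon> x) * signed_sum t x" if "x \<in> ext A" for x
  proof -
    have "of_int (\<epsilon> x) * signed_sum t x = of_int (\<epsilon> x * \<epsilon> x) * ext_sum c x"
      unfolding c(4) signed_sum_lift_weight[OF \<sigma>(2)] using agree that by simp
    then show ?thesis
      using signs_mult_self[OF \<epsilon>] ext_ground[OF A(1) that] ext_sum_nonneg chain_weightD(1)[OF c(1)] by simp
  qed
  ultimately have "signed_sum t \<in> cone A \<epsilon>" by (simp add: cone_def)
  moreover have "t \<in> R" unfolding realization_eq using c \<sigma>(2) by blast
  ultimately show "t \<in> R \<and> signed_sum t \<in> cone A \<epsilon>" by simp
next
  assume t: "t \<in> R \<and> signed_sum t \<in> cone A \<epsilon>"
  then obtain c \<delta> where c: "t = lift_weight c \<delta>" "chain_weight c" "(\<Sum>A\<in>\<L>. c A) = 1" "\<delta> \<in> signs"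
    unfolding realization_eq by auto
  have supp: "signed_sum t x \<noteq> 0" if "c B \<noteq> 0" "x \<in> ext B" for B x
    using ext_sum_nonzero[of c x] chain_weightD[OF c(2)] that abs_signed_sum_lift_weight[OF c(4,2), of x] c(1)
    by fastforce
  have below: "B \<subseteq> A" if "c B \<noteq> 0" for B
    using closed_subset_if_ext_subset[of B A] chain_weightD(3)[OF c(2) that] A(1) supp[OF that] t
    by (auto simp: cone_def)
  \<comment> \<open>A face through the vertex of the star needs the signs \<epsilon> on
    \<open>ext A\<close>. Overwriting \<delta> there does not move t: at an extreme point of a set
    with nonzero weight the coordinate is nonzero, and the cone condition makes \<epsilon> and
    \<delta> agree.\<close>
  define \<delta>' where "\<delta>' = (\<lambda>x. if x \<in> ext A then \<epsilon> x else \<delta> x)"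
  have \<delta>': "\<delta>' \<in> signs"
    using \<epsilon> c(4) ext_ground[OF A(1)] unfolding \<delta>'_def signs_iff by auto
  have agree: "\<delta>' x = \<delta> x" if "c B \<noteq> 0" "x \<in> ext B" for B x
  proof (cases "x \<in> ext A")
    case True
    then have "x \<in> E" using ext_ground[OF A(1)] by auto
    have "0 < of_int (\<epsilon> x) * signed_sum t x"
      using t True supp[OF that] signs_cases[OF \<epsilon> \<open>x \<in> E\<close>] by (fastforce simp: cone_def less_le)
    then have "0 < of_int (\<epsilon> x * \<delta> x) * ext_sum c x"
      unfolding c(1) signed_sum_lift_weight[OF c(4)] by (simp add: mult.assoc)
    then have "0 < \<epsilon> x * \<delta> x"
      using ext_sum_nonneg[of c x] chain_weightD(1)[OF c(2)]
      by (metis of_int_0_less_iff zero_less_mult_pos2 less_le mult_zero_right)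
    then have "\<epsilon> x = \<delta> x"
      using signs_cases[OF \<epsilon> \<open>x \<in> E\<close>] signs_cases[OF c(4) \<open>x \<in> E\<close>] by auto
    then show ?thesis using True by (simp add: \<delta>'_def)
  qed (simp add: \<delta>'_def)
  have t': "t = lift_weight c \<delta>'"
    unfolding c(1)
  proof
    fix X
    show "lift_weight c \<delta> X = lift_weight c \<delta>' X"
      unfolding lift_weight_def
    proof (intro sum.cong refl)
      fix B assume B: "B \<in> \<L>"
      show "(if X = vertex B \<delta> then c B else 0) = (if X = vertex B \<delta>' then c B else 0)"
      proof (cases "c B = 0")
        case False
        then have "vertex B \<delta> = vertex B \<delta>'" using vertex_eq_iff[OF B c(4) B \<delta>'] agree by metis
        then show ?thesis by simp
      qed simp
    qed
  qed
  \<comment> \<open>A may have weight zero in t. It is inserted so that the face contains the vertex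
    of the star.\<close>
  let ?\<sigma> = "insert A {B. c B \<noteq> 0}"
  have "?\<sigma> \<in> chains ({B \<in> \<L>. B \<subseteq> A} - {{}})"
    using chain_weightD(3,4)[OF c(2)] below A unfolding chains_def chain_subset_def by blast
  moreover have "t \<in> geom_simplex ((\<lambda>B. vertex B \<delta>') ` ?\<sigma>)"
    unfolding t' using lift_weight_in_simplex[OF c(2), of ?\<sigma>] chain_weightD(2)[OF c(2)] A(1) \<delta>' c(3) by auto
  moreover have "vertex A \<epsilon> = vertex A \<delta>'"
    using vertex_eq_iff[OF A(1) \<epsilon> A(1) \<delta>'] by (simp add: \<delta>'_def)
  ultimately show "t \<in> cell E cl A \<epsilon>"
    unfolding mem_cell_iff_simplex[OF A(1)] using \<delta>' by blast
qed

text \<open>For the inclusion of cones, a point of \<open>ext B\<close> lying in A is extreme in A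
  by \<open>ext_hereditary\<close>, so its sign is controlled by the common extreme points; outside
  A the coordinate is zero. For the converse a single test vector suffices.\<close>

lemma cell_subset_iff:
  assumes A: "A \<in> \<L>" and \<epsilon>: "\<epsilon> \<in> signs" and B: "B \<in> \<L>" and \<delta>: "\<delta> \<in> signs"
    and "A \<noteq> {}"
  shows "cell E cl A \<epsilon> \<subseteq> cell E cl B \<delta> \<longleftrightarrow> A \<subseteq> B \<and> (\<forall>x\<in>ext A \<inter> ext B. \<epsilon> x = \<delta> x)"
proof
  assume AB: "A \<subseteq> B \<and> (\<forall>x\<in>ext A \<inter> ext B. \<epsilon> x = \<delta> x)"
  have "cone A \<epsilon> \<subseteq> cone B \<delta>"
  proof
    fix v assume v: "v \<in> cone A \<epsilon>"
    have "0 \<le> of_int (\<delta> x) * v x" if "x \<in> ext B" for x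
    proof (cases "x \<in> A")
      case True
      then have "x \<in> ext A" using ext_hereditary[OF A B] AB that by blast
      then show ?thesis using v AB that by (force simp: cone_def)
    next
      case False
      then show ?thesis using v by (simp add: cone_def)
    qed
    then show "v \<in> cone B \<delta>" using v AB by (auto simp: cone_def)
  qed
  moreover have "B \<noteq> {}" using AB assms(5) by auto
  ultimately show "cell E cl A \<epsilon> \<subseteq> cell E cl B \<delta>"
    using mem_cell_iff[OF A assms(5) \<epsilon>] mem_cell_iff[OF B _ \<delta>] by auto
next
  assume sub: "cell E cl A \<epsilon> \<subseteq> cell E cl B \<delta>"
  \<comment> \<open>This vector lies in the cone of (A,\<epsilon>) and vanishes nowhere on A, so its
    support detects whether A is contained in B and its signs detect agreement with
    \<delta>.\<close>
  define v :: "'b \<Rightarrow> real" where "v = (\<lambda>x. if x \<in> A then of_int (\<epsilon> x) else 0)"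
  have ne: "v x \<noteq> 0" if "x \<in> A" for x
    using that signs_cases[OF \<epsilon>, of x] closed_subset[OF A] by (auto simp: v_def)
  have "{x. v x \<noteq> 0} \<subseteq> E" using closed_subset[OF A] by (auto simp: v_def)
  moreover have "v \<noteq> (\<lambda>_. 0)" using ne \<open>A \<noteq> {}\<close> by auto
  ultimately obtain t s where t: "t \<in> R" "0 < s" and Ft: "signed_sum t = (\<lambda>x. s * v x)"
    by (rule signed_sum_surj_ray)
  have "v \<in> cone A \<epsilon>"
    using ext_subset[OF A] by (auto simp: cone_def v_def)
  then have "t \<in> cell E cl A \<epsilon>" using mem_cell_iff[OF A assms(5) \<epsilon>] t cone_scale Ft by simp
  then have tB: "t \<in> cell E cl B \<delta>" using sub by auto
  have "B \<noteq> {}"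
  proof
    assume "B = {}"
    then show False using tB unfolding mem_cell_iff_simplex[OF B] by (auto simp: chains_def)
  qed
  then have "v \<in> cone B \<delta>" using mem_cell_iff[OF B _ \<delta>] tB t(2) Ft cone_scale by auto
  then have vB: "\<And>x. x \<notin> B \<Longrightarrow> v x = 0" "\<And>x. x \<in> ext B \<Longrightarrow> 0 \<le> of_int (\<delta> x) * v x"
    by (auto simp: cone_def)
  have "\<epsilon> x = \<delta> x" if "x \<in> ext A" "x \<in> ext B" for x
  proof -
    have x: "x \<in> A" "x \<in> E" using that(1) ext_subset[OF A] ext_ground[OF A] by auto
    then show ?thesis
      using vB(2)[OF that(2)] signs_cases[OF \<epsilon> x(2)] signs_cases[OF \<delta> x(2)] by (auto simp: v_def)
  qed
  moreover have "A \<subseteq> B" using vB(1) ne by auto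
  ultimately show "A \<subseteq> B \<and> (\<forall>x\<in>ext A \<inter> ext B. \<epsilon> x = \<delta> x)" by auto
qed

text \<open>The support lies between \<open>ext A\<close> and A, both of which have closure
  A.\<close>

lemma open_cone_closure:
  assumes "A \<in> \<L>" "v \<in> open_cone A \<epsilon>"
  shows "cl {x. v x \<noteq> 0} = A"
proof -
  have sub: "{x. v x \<noteq> 0} \<subseteq> A" and sup: "ext A \<subseteq> {x. v x \<noteq> 0}"
    using assms(2) by (auto simp: open_cone_def)
  show ?thesis
    using cl_mono[OF sub] cl_mono[OF sup] cl_ext[OF assms(1)] closed_cl[OF assms(1)] closed_subset[OF assms(1)] sub
    by auto
qed

lemma open_cone_unique:
  assumes "A \<in> \<L>" "v \<in> open_cone A \<epsilon>" "\<epsilon> \<in> signs" "B \<in> \<L>" "v \<in> open_cone B \<delta>" "\<delta> \<in> signs"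
  shows "A = B" "\<And>x. x \<in> ext A \<Longrightarrow> \<epsilon> x = \<delta> x"
proof -
  show AB: "A = B" using open_cone_closure assms by metis
  fix x assume x: "x \<in> ext A"
  then have "0 < of_int (\<epsilon> x) * v x" "0 < of_int (\<delta> x) * v x" using assms AB by (auto simp: open_cone_def)
  then show "\<epsilon> x = \<delta> x"
    using signs_cases[OF assms(3) ext_ground[OF assms(1) x]] signs_cases[OF assms(6) ext_ground[OF assms(1) x]]
    by auto
qed

lemma open_cone_exists:
  assumes "{x. v x \<noteq> 0} \<subseteq> E"
  shows "v \<in> open_cone (cl {x. v x \<noteq> 0}) (sign_of v)"
proof -
  let ?S = "{x. v x \<noteq> 0}"
  have A: "cl ?S \<in> \<L>" using cl_closed[OF assms] .
  have "ext (cl ?S) \<subseteq> ?S" using ext_least[OF A cl_extensive[OF assms]] by simp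
  then have "0 < of_int (sign_of v x) * v x" if "x \<in> ext (cl ?S)" for x
    using sign_of_mult[OF ext_ground[OF A that], of v] that by auto
  then show ?thesis using cl_extensive[OF assms] by (auto simp: open_cone_def)
qed

text \<open>Some extreme point of A has coordinate zero, and a set missing an extreme point does not
  span A. This is why boundary points of a cell belong to open cells of smaller closed sets.\<close>

lemma cone_not_open:
  assumes "A \<in> \<L>" "v \<in> cone A \<epsilon>" "v \<notin> open_cone A \<epsilon>" "\<epsilon> \<in> signs"
  shows "cl {x. v x \<noteq> 0} \<subset> A"
proof -
  have sub: "{x. v x \<noteq> 0} \<subseteq> A" using assms(2) by (auto simp: cone_def)
  obtain x where x: "x \<in> ext A" "of_int (\<epsilon> x) * v x = 0"
    using assms(2,3) by (auto simp: cone_def open_cone_def less_le)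
  then have "v x = 0" using signs_cases[OF assms(4) ext_ground[OF assms(1) x(1)]] by auto
  have "cl {x. v x \<noteq> 0} \<noteq> A" using ext_least[OF assms(1) sub] x \<open>v x = 0\<close> by auto
  moreover have "cl {x. v x \<noteq> 0} \<subseteq> A"
    using cl_mono[OF sub] closed_cl[OF assms(1)] closed_subset[OF assms(1)] by auto
  ultimately show ?thesis by auto
qed

section \<open>The face poset and the barycentric subdivision\<close>

text \<open>\<open>Q_le\<close> asks for some pair of representatives. Within a class they agree on
  the extreme points, so every pair gives the same answer.\<close>

lemma Q_le_vertex:
  assumes "A \<in> \<L>" "\<epsilon> \<in> signs" "B \<in> \<L>" "\<delta> \<in> signs"
  shows "Q_le cl (Elt (vertex A \<epsilon>)) (Elt (vertex B \<delta>)) \<longleftrightarrow> A \<subseteq> B \<and> (\<forall>x\<in>ext A \<inter> ext B. \<epsilon> x = \<delta> x)"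
  using assms by (fastforce simp: vertex_eq)

text \<open>All pairs in a class have the same first component A, so the union of the first
  components recovers A from the class. The value at \<open>Hat1\<close> is a default outside the
  proper part.\<close>

fun cell_of :: "'b signed with_max \<Rightarrow> ('b signed \<Rightarrow> real) set" where
  "cell_of (Elt X) = geom_star (pm_Delta_below E cl (\<Union>(fst ` X))) X"
| "cell_of Hat1 = {}"

lemma cell_of_vertex:
  assumes "A \<in> \<L>" "\<epsilon> \<in> signs"
  shows "cell_of (Elt (vertex A \<epsilon>)) = cell E cl A \<epsilon>"
proof -
  have "fst ` vertex A \<epsilon> = {A}" using vertex_mem[OF assms] by (force simp: vertex_eq[OF assms])
  then show ?thesis by (simp add: cell_def)
qed

lemma cell_eq_iff:
  assumes "A \<in> \<L> - {{}}" "\<epsilon> \<in> signs" "B \<in> \<L> - {{}}" "\<delta> \<in> signs"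
  shows "cell E cl A \<epsilon> = cell E cl B \<delta> \<longleftrightarrow> vertex A \<epsilon> = vertex B \<delta>"
proof -
  have A: "A \<in> \<L>" "A \<noteq> {}" and B: "B \<in> \<L>" "B \<noteq> {}" using assms by auto
  show ?thesis
    unfolding set_eq_subset[of "cell E cl A \<epsilon>"] vertex_eq_iff[OF A(1) assms(2) B(1) assms(4)]
      cell_subset_iff[OF A(1) assms(2) B(1) assms(4) A(2)] cell_subset_iff[OF B(1) assms(4) A(1) assms(2) B(2)]
    by (cases "A = B") auto
qed

lemma inj_on_cell_of: "inj_on (\<lambda>v. cell_of (Elt v)) {vertex A \<epsilon> | A \<epsilon>. A \<in> \<L> - {{}} \<and> \<epsilon> \<in> signs}"
proof (rule inj_onI)
  fix X Y
  assume X: "X \<in> {vertex A \<epsilon> | A \<epsilon>. A \<in> \<L> - {{}} \<and> \<epsilon> \<in> signs}"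
    and Y: "Y \<in> {vertex A \<epsilon> | A \<epsilon>. A \<in> \<L> - {{}} \<and> \<epsilon> \<in> signs}"
    and eq: "cell_of (Elt X) = cell_of (Elt Y)"
  obtain A \<epsilon> where A: "X = vertex A \<epsilon>" "A \<in> \<L> - {{}}" "\<epsilon> \<in> signs" using X by blast
  obtain B \<delta> where B: "Y = vertex B \<delta>" "B \<in> \<L> - {{}}" "\<delta> \<in> signs" using Y by blast
  have "cell E cl A \<epsilon> = cell E cl B \<delta>"
    using eq A B cell_of_vertex[of A \<epsilon>] cell_of_vertex[of B \<delta>] by auto
  then show "X = Y" using A B cell_eq_iff[of A \<epsilon> B \<delta>] by simp
qed

lemma Q_proper_part:
  "Q_poset E cl - {Q_bot E, Hat1} = {Elt (vertex A \<epsilon>) | A \<epsilon>. A \<in> \<L> - {{}} \<and> \<epsilon> \<in> signs}"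
proof -
  have ext0: "ext {} = {}" using ext_subset[OF empty_closed] by auto
  have bot: "vertex {} \<epsilon> = {{}} \<times> signs" if "\<epsilon> \<in> signs" for \<epsilon>
    using vertex_eq[OF empty_closed that] ext0 by auto
  have "vertex A \<epsilon> \<noteq> {{}} \<times> signs" if "A \<in> \<L> - {{}}" "\<epsilon> \<in> signs" for A \<epsilon>
    using vertex_mem[of A \<epsilon>] that by auto
  then show ?thesis using bot unfolding Q_poset_def Q_bot_def by blast
qed

lemma face_poset:
  "poset_isomorphism (Q_poset E cl - {Q_bot E, Hat1}) (Q_le cl) (Sigma_cells E cl) (\<subseteq>) cell_of"
  unfolding poset_isomorphism_def Q_proper_part
proof (intro conjI ballI)
  show "bij_betw cell_of {Elt (vertex A \<epsilon>) | A \<epsilon>. A \<in> \<L> - {{}} \<and> \<epsilon> \<in> signs} (Sigma_cells E cl)"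
    unfolding bij_betw_def
  proof
    show "inj_on cell_of {Elt (vertex A \<epsilon>) | A \<epsilon>. A \<in> \<L> - {{}} \<and> \<epsilon> \<in> signs}"
      using inj_on_cell_of unfolding inj_on_def by blast
    show "cell_of ` {Elt (vertex A \<epsilon>) | A \<epsilon>. A \<in> \<L> - {{}} \<and> \<epsilon> \<in> signs} = Sigma_cells E cl"
      unfolding Sigma_cells_def using cell_of_vertex by (force simp del: cell_of.simps)
  qed
  fix p q assume "p \<in> {Elt (vertex A \<epsilon>) | A \<epsilon>. A \<in> \<L> - {{}} \<and> \<epsilon> \<in> signs}"
    "q \<in> {Elt (vertex A \<epsilon>) | A \<epsilon>. A \<in> \<L> - {{}} \<and> \<epsilon> \<in> signs}"
  then obtain A \<epsilon> B \<delta> where "A \<in> \<L>" "A \<noteq> {}" "\<epsilon> \<in> signs" "p = Elt (vertex A \<epsilon>)"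
    "B \<in> \<L>" "\<delta> \<in> signs" "q = Elt (vertex B \<delta>)" by blast
  then show "Q_le cl p q \<longleftrightarrow> cell_of p \<subseteq> cell_of q"
    using Q_le_vertex[of A \<epsilon> B \<delta>] cell_subset_iff[of A \<epsilon> B \<delta>] cell_of_vertex by metis
qed

text \<open>A chain of cells carries one sign vector per cell with pairwise agreement, whereas a
  face of \<open>pm_Delta\<close> has a single one. Take at x the sign of any member having x as an
  extreme point; pairwise agreement makes the choice immaterial. Elsewhere the sign is 1 by
  default.\<close>

lemma chain_common_sign:
  assumes "\<And>i. i \<in> I \<Longrightarrow> \<A> i \<in> \<L> \<and> \<E> i \<in> signs"
    and "\<And>i j x. i \<in> I \<Longrightarrow> j \<in> I \<Longrightarrow> x \<in> ext (\<A> i) \<Longrightarrow> x \<in> ext (\<A> j) \<Longrightarrow> \<E> i x = \<E> j x"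
  obtains \<delta> where "\<delta> \<in> signs" "\<forall>i\<in>I. \<forall>x\<in>ext (\<A> i). \<delta> x = \<E> i x"
proof -
  define k where "k = (\<lambda>x. SOME i. i \<in> I \<and> x \<in> ext (\<A> i))"
  define \<delta> where "\<delta> = (\<lambda>x\<in>E. if \<exists>i\<in>I. x \<in> ext (\<A> i) then \<E> (k x) x else 1)"
  have k: "k x \<in> I" "x \<in> ext (\<A> (k x))" if "i \<in> I" "x \<in> ext (\<A> i)" for i x
    using someI[of "\<lambda>i. i \<in> I \<and> x \<in> ext (\<A> i)" i] that unfolding k_def by blast+
  have "\<delta> x = \<E> i x" if "i \<in> I" "x \<in> ext (\<A> i)" for i x
  proof -
    have "x \<in> E" using ext_ground assms(1) that by blast
    then have "\<delta> x = \<E> (k x) x" using that by (auto simp: \<delta>_def)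
    also have "\<dots> = \<E> i x" using assms(2)[OF k(1)[OF that] that(1) k(2)[OF that] that(2)] .
    finally show ?thesis .
  qed
  moreover have "\<delta> \<in> signs"
    unfolding signs_iff[of \<delta>]
  proof (intro conjI ballI allI impI)
    fix x assume x: "x \<in> E"
    show "\<delta> x = 1 \<or> \<delta> x = -1"
    proof (cases "\<exists>i\<in>I. x \<in> ext (\<A> i)")
      case True
      then have "\<E> (k x) \<in> signs" using k assms(1) by blast
      then show ?thesis using signs_cases[OF _ x] x True by (simp add: \<delta>_def)
    next
      case False
      then show ?thesis using x by (auto simp: \<delta>_def)
    qed
  qed (simp add: \<delta>_def)
  ultimately show ?thesis using that by blast
qed

lemma Sigma_cells_comparable:
  assumes "\<sigma> \<in> chains (\<L> - {{}})" "\<epsilon> \<in> signs" "A \<in> \<sigma>" "B \<in> \<sigma>" "A \<subseteq> B"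
  shows "cell E cl A \<epsilon> \<subseteq> cell E cl B \<epsilon>"
  using assms cell_subset_iff[of A \<epsilon> B \<epsilon>] by (auto simp: chains_def)

lemma barycentric_subdivision:
  "simplicial_isomorphism (pm_Delta E cl) (order_complex (Sigma_cells E cl)) (\<lambda>v. cell_of (Elt v))"
  unfolding simplicial_isomorphism_def
proof
  have PL: "\<L> - {{}} \<subseteq> \<L>" by auto
  have face: "pm_Delta E cl = {(\<lambda>A. vertex A \<epsilon>) ` \<sigma> | \<sigma> \<epsilon>. \<sigma> \<in> chains (\<L> - {{}}) \<and> \<epsilon> \<in> signs}"
    unfolding pm_Delta_def pm_complex_def order_complex_closed[OF PL] ..
  have "\<Union>(pm_Delta E cl) \<subseteq> {vertex A \<epsilon> | A \<epsilon>. A \<in> \<L> - {{}} \<and> \<epsilon> \<in> signs}"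
    unfolding face by (auto simp: chains_def) blast+
  then show "inj_on (\<lambda>v. cell_of (Elt v)) (\<Union>(pm_Delta E cl))" by (rule inj_on_subset[OF inj_on_cell_of])
  have img: "(\<lambda>v. cell_of (Elt v)) ` (\<lambda>A. vertex A \<epsilon>) ` \<sigma> = (\<lambda>A. cell E cl A \<epsilon>) ` \<sigma>"
    if "\<sigma> \<in> chains (\<L> - {{}})" "\<epsilon> \<in> signs" for \<sigma> \<epsilon>
    unfolding image_image using that cell_of_vertex by (intro image_cong) (auto simp: chains_def)
  show "(\<lambda>\<sigma>. (\<lambda>v. cell_of (Elt v)) ` \<sigma>) ` pm_Delta E cl = order_complex (Sigma_cells E cl)"
  proof (intro equalityI subsetI)
    fix \<C> assume "\<C> \<in> (\<lambda>\<sigma>. (\<lambda>v. cell_of (Elt v)) ` \<sigma>) ` pm_Delta E cl"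
    then obtain \<sigma> \<epsilon> where \<sigma>: "\<sigma> \<in> chains (\<L> - {{}})" "\<epsilon> \<in> signs"
      and "\<C> = (\<lambda>v. cell_of (Elt v)) ` (\<lambda>A. vertex A \<epsilon>) ` \<sigma>"
      unfolding face by blast
    then have \<C>: "\<C> = (\<lambda>A. cell E cl A \<epsilon>) ` \<sigma>" using img by simp
    have "\<sigma> \<subseteq> \<L> - {{}}" using \<sigma> by (simp add: chains_def)
    then have "\<C> \<subseteq> Sigma_cells E cl"
      using \<sigma>(2) unfolding \<C> Sigma_cells_def by blast
    moreover have "finite \<C>"
      unfolding \<C> using \<open>\<sigma> \<subseteq> \<L> - {{}}\<close> finite_subset_closed[of \<sigma>] by blast
    moreover have "C \<subseteq> D \<or> D \<subseteq> C" if CD: "C \<in> \<C>" "D \<in> \<C>" for C D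
    proof -
      obtain A B where AB: "A \<in> \<sigma>" "C = cell E cl A \<epsilon>" "B \<in> \<sigma>" "D = cell E cl B \<epsilon>" using CD \<C> by auto
      then have "A \<subseteq> B \<or> B \<subseteq> A" using \<sigma>(1) by (auto simp: chains_def chain_subset_def)
      then show ?thesis using Sigma_cells_comparable[OF \<sigma>] AB by blast
    qed
    ultimately show "\<C> \<in> order_complex (Sigma_cells E cl)"
      by (auto simp: order_complex_def chains_def chain_subset_def)
  next
    fix \<C> assume "\<C> \<in> order_complex (Sigma_cells E cl)"
    then have \<C>: "\<C> \<subseteq> Sigma_cells E cl" "\<And>C D. C \<in> \<C> \<Longrightarrow> D \<in> \<C> \<Longrightarrow> C \<subseteq> D \<or> D \<subseteq> C"
      by (auto simp: order_complex_def chains_def chain_subset_def)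
    have "\<forall>C\<in>\<C>. \<exists>p. fst p \<in> \<L> - {{}} \<and> snd p \<in> signs \<and> C = cell E cl (fst p) (snd p)"
      using \<C>(1) by (fastforce simp: Sigma_cells_def)
    then obtain p where p: "\<And>C. C \<in> \<C> \<Longrightarrow> fst (p C) \<in> \<L> - {{}}" "\<And>C. C \<in> \<C> \<Longrightarrow> snd (p C) \<in> signs"
      "\<And>C. C \<in> \<C> \<Longrightarrow> C = cell E cl (fst (p C)) (snd (p C))"
      using bchoice by metis
    have order: "fst (p C) \<subseteq> fst (p D) \<and> (\<forall>x\<in>ext (fst (p C)) \<inter> ext (fst (p D)). snd (p C) x = snd (p D) x)"
      if "C \<in> \<C>" "D \<in> \<C>" "C \<subseteq> D" for C D
      using cell_subset_iff[of "fst (p C)" "snd (p C)" "fst (p D)" "snd (p D)"] p[OF that(1)] p[OF that(2)] that(3)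
      by auto
    have mem: "fst (p C) \<in> \<L> \<and> snd (p C) \<in> signs" if "C \<in> \<C>" for C
      using p(1,2)[OF that] by auto
    \<comment> \<open>Comparable cells agree on common extreme points, and in a chain any two cells
      are comparable.\<close>
    have agree: "snd (p C) x = snd (p D) x"
      if "C \<in> \<C>" "D \<in> \<C>" "x \<in> ext (fst (p C))" "x \<in> ext (fst (p D))" for C D x
      using order[OF that(1,2)] order[OF that(2,1)] \<C>(2)[OF that(1,2)] that(3,4) by (metis IntI)
    obtain \<delta> where \<delta>: "\<delta> \<in> signs" "\<forall>C\<in>\<C>. \<forall>x\<in>ext (fst (p C)). \<delta> x = snd (p C) x"
      by (rule chain_common_sign[of \<C> "\<lambda>C. fst (p C)" "\<lambda>C. snd (p C)", OF mem agree])
    let ?\<sigma> = "(\<lambda>C. fst (p C)) ` \<C>"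
    have \<sigma>: "?\<sigma> \<in> chains (\<L> - {{}})"
    proof -
      have "fst (p C) \<subseteq> fst (p D) \<or> fst (p D) \<subseteq> fst (p C)" if "C \<in> \<C>" "D \<in> \<C>" for C D
        using order[OF that] order[OF that(2,1)] \<C>(2)[OF that] by blast
      then show ?thesis unfolding chains_def chain_subset_def using p(1) by blast
    qed
    have "cell E cl (fst (p C)) \<delta> = C" if "C \<in> \<C>" for C
    proof -
      have "vertex (fst (p C)) \<delta> = vertex (fst (p C)) (snd (p C))"
        using vertex_eq_iff[of "fst (p C)" \<delta> "fst (p C)" "snd (p C)"] mem[OF that] \<delta> that by blast
      then show ?thesis using cell_eq_iff[of "fst (p C)" \<delta> "fst (p C)" "snd (p C)"] p[OF that] \<delta>(1) by simp
    qed
    then have "(\<lambda>A. cell E cl A \<delta>) ` ?\<sigma> = \<C>" unfolding image_image by simp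
    then have "\<C> = (\<lambda>v. cell_of (Elt v)) ` (\<lambda>A. vertex A \<delta>) ` ?\<sigma>" using img[OF \<sigma> \<delta>(1)] by simp
    moreover have "(\<lambda>A. vertex A \<delta>) ` ?\<sigma> \<in> pm_Delta E cl" unfolding face using \<sigma> \<delta>(1) by blast
    ultimately show "\<C> \<in> (\<lambda>\<sigma>. (\<lambda>v. cell_of (Elt v)) ` \<sigma>) ` pm_Delta E cl" by (rule image_eqI)
  qed
qed

end

section \<open>Spheres and ball charts\<close>

text \<open>Renaming coordinates along a bijection preserves sums of squares, so the same map
  carries standard balls and spheres to those indexed by S.\<close>

lemma Euclidean_space_reindex:
  assumes "finite S"
  obtains f where "homeomorphic_map (Euclidean_space (card S)) (top_of_set {y :: 'b \<Rightarrow> real. \<forall>x. x \<notin> S \<longrightarrow> y x = 0}) f"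
    "\<forall>z. (\<Sum>x\<in>S. (f z x)\<^sup>2) = (\<Sum>i<card S. (z i)\<^sup>2)"
proof -
  obtain e where e: "bij_betw e S {0..<card S}" using ex_bij_betw_finite_nat[OF assms] by auto
  define f where "f = (\<lambda>z :: nat \<Rightarrow> real. \<lambda>x. if x \<in> S then z (e x) else 0)"
  define g where "g = (\<lambda>y :: 'b \<Rightarrow> real. \<lambda>i. if i < card S then y (inv_into S e i) else 0)"
  have ES: "Euclidean_space (card S) = top_of_set {z. \<forall>i\<ge>card S. z i = 0}"
    by (simp add: Euclidean_space_def euclidean_product_topology)
  have es: "e x < card S" if "x \<in> S" for x using bij_betwE[OF e] that by auto
  have inv: "inv_into S e i \<in> S" "e (inv_into S e i) = i" if "i < card S" for i
    using bij_betw_inv_into_right[OF e, of i] bij_betwE[OF bij_betw_inv_into[OF e]] that by auto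
  have inv': "inv_into S e (e x) = x" if "x \<in> S" for x
    using bij_betw_inv_into_left[OF e that] .
  have cf: "continuous_on T f" for T
    unfolding f_def
  proof (rule continuous_on_coordinatewise_then_product)
    show "continuous_on T (\<lambda>z. if x \<in> S then z (e x) else 0)" for x
      by (cases "x \<in> S") (auto intro: continuous_on_product_then_coordinatewise[OF continuous_on_id])
  qed
  have cg: "continuous_on T g" for T
    unfolding g_def
  proof (rule continuous_on_coordinatewise_then_product)
    show "continuous_on T (\<lambda>y. if i < card S then y (inv_into S e i) else 0)" for i
      by (cases "i < card S") (auto intro: continuous_on_product_then_coordinatewise[OF continuous_on_id])
  qed
  have "homeomorphic_maps (Euclidean_space (card S)) (top_of_set {y. \<forall>x. x \<notin> S \<longrightarrow> y x = 0}) f g"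
    unfolding homeomorphic_maps_def ES
  proof (intro conjI ballI)
    show "continuous_map (top_of_set {z. \<forall>i\<ge>card S. z i = 0}) (top_of_set {y. \<forall>x. x \<notin> S \<longrightarrow> y x = 0}) f"
      using cf by (auto simp: continuous_map_in_subtopology f_def)
    show "continuous_map (top_of_set {y. \<forall>x. x \<notin> S \<longrightarrow> y x = 0}) (top_of_set {z. \<forall>i\<ge>card S. z i = 0}) g"
      using cg by (auto simp: continuous_map_in_subtopology g_def)
    show "g (f z) = z" if "z \<in> topspace (top_of_set {z. \<forall>i\<ge>card S. z i = 0})" for z
      using that inv by (auto simp: f_def g_def fun_eq_iff)
    show "f (g y) = y" if "y \<in> topspace (top_of_set {y. \<forall>x. x \<notin> S \<longrightarrow> y x = 0})" for y
      using that inv' es by (auto simp: f_def g_def fun_eq_iff)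
  qed
  then have "homeomorphic_map (Euclidean_space (card S)) (top_of_set {y. \<forall>x. x \<notin> S \<longrightarrow> y x = 0}) f"
    using homeomorphic_map_maps by blast
  moreover have "(\<Sum>x\<in>S. (f z x)\<^sup>2) = (\<Sum>i<card S. (z i)\<^sup>2)" for z
  proof -
    have "(\<Sum>x\<in>S. (f z x)\<^sup>2) = (\<Sum>x\<in>S. (z (e x))\<^sup>2)" by (simp add: f_def)
    also have "\<dots> = (\<Sum>i\<in>{0..<card S}. (z i)\<^sup>2)" by (rule sum.reindex_bij_betw[OF e])
    finally show ?thesis by (simp add: atLeast0LessThan)
  qed
  ultimately show ?thesis using that by blast
qed

definition fun_ball :: "'b set \<Rightarrow> ('b \<Rightarrow> real) set" where
  "fun_ball S = {y. (\<forall>x. x \<notin> S \<longrightarrow> y x = 0) \<and> (\<Sum>x\<in>S. (y x)\<^sup>2) \<le> 1}"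

definition fun_sphere :: "'b set \<Rightarrow> ('b \<Rightarrow> real) set" where
  "fun_sphere S = {y. (\<forall>x. x \<notin> S \<longrightarrow> y x = 0) \<and> (\<Sum>x\<in>S. (y x)\<^sup>2) = 1}"

lemma nball_homeomorphic_fun_ball:
  assumes "finite S"
  obtains f where "homeomorphic_map (nball (card S)) (top_of_set (fun_ball S)) f"
    "\<forall>z. (\<Sum>x\<in>S. (f z x)\<^sup>2) = (\<Sum>i<card S. (z i)\<^sup>2)"
proof -
  obtain f where f: "homeomorphic_map (Euclidean_space (card S)) (top_of_set {y :: 'a \<Rightarrow> real. \<forall>x. x \<notin> S \<longrightarrow> y x = 0}) f"
    "\<forall>z. (\<Sum>x\<in>S. (f z x)\<^sup>2) = (\<Sum>i<card S. (z i)\<^sup>2)"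
    by (rule Euclidean_space_reindex[OF assms])
  have "homeomorphic_map (nball (card S))
      (subtopology (top_of_set {y. \<forall>x. x \<notin> S \<longrightarrow> y x = 0}) {y. (\<Sum>x\<in>S. (y x)\<^sup>2) \<le> 1}) f"
    unfolding nball_def by (rule homeomorphic_map_subtopologies_alt[OF f(1)]) (simp add: f(2))
  also have "subtopology (top_of_set {y. \<forall>x. x \<notin> S \<longrightarrow> y x = 0}) {y. (\<Sum>x\<in>S. (y x)\<^sup>2) \<le> 1} = top_of_set (fun_ball S)"
    unfolding subtopology_subtopology fun_ball_def by (simp add: Collect_conj_eq)
  finally show ?thesis using that f(2) by blast
qed

lemma nsphere_homeomorphic_fun_sphere:
  assumes "finite S" "S \<noteq> {}"
  shows "nsphere (card S - 1) homeomorphic_space top_of_set (fun_sphere S)"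
proof -
  obtain f where f: "homeomorphic_map (Euclidean_space (card S)) (top_of_set {y :: 'a \<Rightarrow> real. \<forall>x. x \<notin> S \<longrightarrow> y x = 0}) f"
    "\<forall>z. (\<Sum>x\<in>S. (f z x)\<^sup>2) = (\<Sum>i<card S. (z i)\<^sup>2)"
    by (rule Euclidean_space_reindex[OF assms(1)])
  \<comment> \<open>\<open>nsphere d\<close> lies in a space with d + 1 coordinates, so S must be
    nonempty for the index to match.\<close>
  have card: "Suc (card S - 1) = card S" using assms by (simp add: card_gt_0_iff)
  have "homeomorphic_map (nsphere (card S - 1))
      (subtopology (top_of_set {y. \<forall>x. x \<notin> S \<longrightarrow> y x = 0}) {y. (\<Sum>x\<in>S. (y x)\<^sup>2) = 1}) f"
    unfolding nsphere_def lessThan_Suc_atMost[symmetric] card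
    by (rule homeomorphic_map_subtopologies_alt[OF f(1)]) (simp add: f(2))
  also have "subtopology (top_of_set {y. \<forall>x. x \<notin> S \<longrightarrow> y x = 0}) {y. (\<Sum>x\<in>S. (y x)\<^sup>2) = 1} = top_of_set (fun_sphere S)"
    unfolding subtopology_subtopology fun_sphere_def by (simp add: Collect_conj_eq)
  finally show ?thesis by (rule homeomorphic_map_imp_homeomorphic_space)
qed

lemma compact_fun_ball:
  assumes "finite S"
  shows "compact (fun_ball S)"
proof -
  have "\<bar>y x\<bar> \<le> 1" if "y \<in> fun_ball S" "x \<in> S" for y x
  proof -
    have "(y x)\<^sup>2 \<le> (\<Sum>x\<in>S. (y x)\<^sup>2)" using assms that(2) by (intro member_le_sum) auto
    also have "\<dots> \<le> 1" using that(1) by (simp add: fun_ball_def)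
    finally show ?thesis by (simp add: abs_square_le_1)
  qed
  then have eq: "fun_ball S = {t. \<forall>v. if v \<in> S then \<bar>t v\<bar> \<le> 1 else t v = 0} \<inter> {y. (\<Sum>x\<in>S. (y x)\<^sup>2) \<le> 1}"
    by (auto simp: fun_ball_def)
  have "closed {y :: 'a \<Rightarrow> real. (\<Sum>x\<in>S. (y x)\<^sup>2) \<le> 1}"
    by (intro closed_Collect_le continuous_intros continuous_on_product_coordinates)
  then show ?thesis unfolding eq by (rule compact_Int_closed[OF compact_cube])
qed

section \<open>Minima over finite index sets\<close>

lemma continuous_on_Min_image:
  fixes f :: "'x :: topological_space \<Rightarrow> 'i \<Rightarrow> real"
  assumes "finite I" "I \<noteq> {}" "\<And>i. i \<in> I \<Longrightarrow> continuous_on S (\<lambda>y. f y i)"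
  shows "continuous_on S (\<lambda>y. Min (f y ` I))"
  using assms
proof (induction I rule: finite_ne_induct)
  case (insert i I)
  then have "continuous_on S (\<lambda>y. min (f y i) (Min (f y ` I)))"
    by (intro continuous_on_min) auto
  then show ?case using insert by simp
qed simp

lemma Min_image_add:
  fixes f :: "'i \<Rightarrow> real"
  assumes "finite I" "I \<noteq> {}"
  shows "Min ((\<lambda>i. f i + a) ` I) = Min (f ` I) + a"
  using mono_Min_commute[of "\<lambda>x. x + a" "f ` I"] assms by (simp add: mono_def image_image)

lemma Min_image_scale:
  fixes f :: "'i \<Rightarrow> real"
  assumes "finite I" "I \<noteq> {}" "0 < s"
  shows "Min ((\<lambda>i. s * f i) ` I) = s * Min (f ` I)"
  using mono_Min_commute[of "\<lambda>x. s * x" "f ` I"] assms by (simp add: mono_def image_image)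

context convex_closure
begin

section \<open>Radial projection of the realization onto the unit sphere\<close>

definition nrm :: "('b \<Rightarrow> real) \<Rightarrow> real" where
  "nrm v = sqrt (\<Sum>x\<in>E. (v x)\<^sup>2)"

definition nonzero_vectors :: "('b \<Rightarrow> real) set" where
  "nonzero_vectors = {v. (\<forall>x. x \<notin> E \<longrightarrow> v x = 0) \<and> v \<noteq> (\<lambda>_. 0)}"

lemma nonzero_vectors_subset: "v \<in> nonzero_vectors \<Longrightarrow> {x. v x \<noteq> 0} \<subseteq> E" "v \<in> nonzero_vectors \<Longrightarrow> v \<noteq> (\<lambda>_. 0)"
  by (auto simp: nonzero_vectors_def)

lemma signed_sum_nonzero_vectors: "t \<in> R \<Longrightarrow> signed_sum t \<in> nonzero_vectors"
  using signed_sum_nonzero signed_sum_support by (fastforce simp: nonzero_vectors_def)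

lemma nrm_pos:
  assumes "v \<in> nonzero_vectors"
  shows "0 < nrm v"
proof -
  obtain x where "v x \<noteq> 0" using nonzero_vectors_subset(2)[OF assms] by auto
  moreover from this have "x \<in> E" using nonzero_vectors_subset(1)[OF assms] by auto
  ultimately have "0 < (\<Sum>x\<in>E. (v x)\<^sup>2)" using finite_ground by (intro sum_pos2[of _ x]) auto
  then show ?thesis by (simp add: nrm_def)
qed

lemma nrm_scale: "0 < s \<Longrightarrow> nrm (\<lambda>x. s * v x) = s * nrm v"
  by (simp add: nrm_def power_mult_distrib sum_distrib_left[symmetric] real_sqrt_mult)

lemma continuous_on_normalize: "continuous_on nonzero_vectors (\<lambda>v x. v x / nrm v)"
  unfolding nrm_def
  by (intro continuous_on_coordinatewise_then_product continuous_intros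
      continuous_on_product_then_coordinatewise[OF continuous_on_id])
    (use nrm_pos in \<open>force simp: nrm_def\<close>)+

lemma normalize_sphere:
  assumes "v \<in> nonzero_vectors"
  shows "(\<lambda>x. v x / nrm v) \<in> fun_sphere E"
proof -
  have "(nrm v)\<^sup>2 = (\<Sum>x\<in>E. (v x)\<^sup>2)" unfolding nrm_def by (simp add: sum_nonneg)
  moreover have "(\<Sum>x\<in>E. (v x / nrm v)\<^sup>2) = (\<Sum>x\<in>E. (v x)\<^sup>2) / (nrm v)\<^sup>2"
    by (simp only: power_divide sum_divide_distrib)
  moreover have "(nrm v)\<^sup>2 \<noteq> 0" using nrm_pos[OF assms] by simp
  ultimately have "(\<Sum>x\<in>E. (v x / nrm v)\<^sup>2) = 1" by simp
  then show ?thesis using assms by (simp add: fun_sphere_def nonzero_vectors_def)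
qed

definition sphere_map :: "('b signed \<Rightarrow> real) \<Rightarrow> 'b \<Rightarrow> real" where
  "sphere_map t = (\<lambda>x. signed_sum t x / nrm (signed_sum t))"

text \<open>A continuous bijection from a compact to a Hausdorff space. Bijectivity is the statement
  that the image of the realization meets each ray exactly once.\<close>

lemma homeomorphic_map_sphere_map: "homeomorphic_map (top_of_set R) (top_of_set (fun_sphere E)) sphere_map"
proof (rule continuous_imp_homeomorphic_map)
  have sub: "signed_sum ` R \<subseteq> nonzero_vectors" using signed_sum_nonzero_vectors by auto
  have cont: "continuous_on R sphere_map"
    using continuous_on_compose2[OF continuous_on_normalize continuous_on_signed_sum sub] by (simp add: sphere_map_def)
  have into: "sphere_map t \<in> fun_sphere E" if "t \<in> R" for t
    unfolding sphere_map_def using normalize_sphere[OF signed_sum_nonzero_vectors[OF that]] .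
  show "continuous_map (top_of_set R) (top_of_set (fun_sphere E)) sphere_map"
    using cont into by (auto simp: continuous_map_in_subtopology)
  show "compact_space (top_of_set R)"
    using compact_realization by (simp add: compact_space_subtopology)
  show "Hausdorff_space (top_of_set (fun_sphere E))" by (rule Hausdorff_euclidean_fun)
  have "v \<in> sphere_map ` R" if v: "v \<in> fun_sphere E" for v
  proof -
    have nv: "nrm v = 1" using v by (simp add: nrm_def fun_sphere_def)
    have "{x. v x \<noteq> 0} \<subseteq> E" "v \<noteq> (\<lambda>_. 0)" using v by (auto simp: fun_sphere_def)
    then obtain t s where t: "t \<in> R" "0 < s" "signed_sum t = (\<lambda>x. s * v x)" by (rule signed_sum_surj_ray)
    then have "sphere_map t = v" using nrm_scale[OF t(2), of v] nv by (simp add: sphere_map_def)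
    then show ?thesis using t(1) by auto
  qed
  then show "sphere_map ` topspace (top_of_set R) = topspace (top_of_set (fun_sphere E))" using into by auto
  show "inj_on sphere_map (topspace (top_of_set R))"
  proof (rule inj_onI)
    fix t t' assume "t \<in> topspace (top_of_set R)" "t' \<in> topspace (top_of_set R)" and eq: "sphere_map t = sphere_map t'"
    then have t: "t \<in> R" "t' \<in> R" by auto
    have pos: "0 < nrm (signed_sum t)" "0 < nrm (signed_sum t')" using nrm_pos signed_sum_nonzero_vectors t by auto
    have "signed_sum t x = (nrm (signed_sum t) / nrm (signed_sum t')) * signed_sum t' x" for x
      using fun_cong[OF eq, of x] pos by (simp add: sphere_map_def field_simps)
    then show "t = t'" using signed_sum_inj_ray[OF t, of "nrm (signed_sum t) / nrm (signed_sum t')"] pos by simp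
  qed
qed

lemma realization_sphere:
  assumes "E \<noteq> {}"
  shows "top_of_set R homeomorphic_space nsphere (card E - 1)"
  using homeomorphic_map_imp_homeomorphic_space[OF homeomorphic_map_sphere_map]
    nsphere_homeomorphic_fun_sphere[OF finite_ground assms]
  by (meson homeomorphic_space_sym homeomorphic_space_trans)

text \<open>G sends a nonzero vector to the point of the realization on its ray: normalise, then
  apply the inverse of \<open>sphere_map\<close>, which supplies the continuity. It carries charts
  of cones over to charts of cells.\<close>

lemma ray_section:
  obtains G where "continuous_on nonzero_vectors G"
    "\<forall>v\<in>nonzero_vectors. G v \<in> R \<and> (\<exists>k>0. signed_sum (G v) = (\<lambda>x. k * v x))"
proof -
  obtain g where g: "homeomorphic_maps (top_of_set R) (top_of_set (fun_sphere E)) sphere_map g"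
    using homeomorphic_map_sphere_map homeomorphic_map_maps by blast
  then have cg: "continuous_on (fun_sphere E) g" and gR: "\<And>v. v \<in> fun_sphere E \<Longrightarrow> g v \<in> R"
    and Hg: "\<And>v. v \<in> fun_sphere E \<Longrightarrow> sphere_map (g v) = v"
    by (auto simp: homeomorphic_maps_def continuous_map_in_subtopology)
  define G where "G = (\<lambda>v. g (\<lambda>x. v x / nrm v))"
  have "continuous_on nonzero_vectors G"
    unfolding G_def using normalize_sphere
    by (intro continuous_on_compose2[OF cg continuous_on_normalize]) auto
  moreover have "G v \<in> R \<and> (\<exists>k>0. signed_sum (G v) = (\<lambda>x. k * v x))" if v: "v \<in> nonzero_vectors" for v
  proof -
    have G: "G v \<in> R" "sphere_map (G v) = (\<lambda>x. v x / nrm v)"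
      unfolding G_def using normalize_sphere[OF v] gR Hg by auto
    have pos: "0 < nrm v" "0 < nrm (signed_sum (G v))" using nrm_pos v signed_sum_nonzero_vectors G by auto
    have "signed_sum (G v) = (\<lambda>x. (nrm (signed_sum (G v)) / nrm v) * v x)"
    proof
      show "signed_sum (G v) x = (nrm (signed_sum (G v)) / nrm v) * v x" for x
        using fun_cong[OF G(2), of x] pos by (simp add: sphere_map_def field_simps)
    qed
    moreover have "0 < nrm (signed_sum (G v)) / nrm v" using pos by simp
    ultimately show ?thesis using G(1) by blast
  qed
  ultimately show ?thesis using that by blast
qed

text \<open>The height over the boundary of the cone: for vectors supported on A, the cone is given
  by height at least 0 and its relative interior by positive height. Adding k times \<epsilon> on
  \<open>ext A\<close> raises the height by k.\<close>

definition ext_min :: "'b set \<Rightarrow> ('b \<Rightarrow> int) \<Rightarrow> ('b \<Rightarrow> real) \<Rightarrow> real" where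
  "ext_min A \<epsilon> y = Min ((\<lambda>x. of_int (\<epsilon> x) * y x) ` ext A)"

definition radius :: "'b set \<Rightarrow> ('b \<Rightarrow> real) \<Rightarrow> real" where
  "radius S y = sqrt (\<Sum>x\<in>S. (y x)\<^sup>2)"

text \<open>The cone of \<open>(A,\<epsilon>)\<close> is the sum of its boundary and the ray through \<open>\<epsilon>\<close> on \<open>ext A\<close>, and its
  boundary is a graph over the coordinate hyperplane of any \<open>p \<in> ext A\<close>. The chart sends a point of
  the unit ball of that hyperplane, at distance \<open>r\<close> from the centre, to the point above it at height
  \<open>1 - r\<close> over the boundary of the cone.\<close>

definition chart :: "'b set \<Rightarrow> ('b \<Rightarrow> int) \<Rightarrow> 'b \<Rightarrow> ('b \<Rightarrow> real) \<Rightarrow> 'b \<Rightarrow> real" where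
  "chart A \<epsilon> p y = (\<lambda>x. y x +
     (if x \<in> ext A then (1 - radius (A - {p}) y - ext_min A \<epsilon> y) * of_int (\<epsilon> x) else 0))"

section \<open>Charts of the cones\<close>

context
  fixes A \<epsilon> p
  assumes A: "A \<in> \<L>" and \<epsilon>: "\<epsilon> \<in> signs" and p: "p \<in> ext A"
begin

lemma ext_sign_mult: "x \<in> ext A \<Longrightarrow> of_int (\<epsilon> x) * (of_int (\<epsilon> x) * a) = (a :: real)"
  using signs_mult_self[OF \<epsilon> ext_ground[OF A]] by (metis mult.assoc mult_1 of_int_1 of_int_mult)

lemma continuous_on_chart: "continuous_on S (chart A \<epsilon> p)"
proof -
  have m: "continuous_on S (ext_min A \<epsilon>)"
    unfolding ext_min_def using finite_ext[OF A] p
    by (intro continuous_on_Min_image continuous_intros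
        continuous_on_product_then_coordinatewise[OF continuous_on_id]) auto
  have r: "continuous_on S (radius (A - {p}))"
    unfolding radius_def
    by (intro continuous_intros continuous_on_product_then_coordinatewise[OF continuous_on_id])
  show ?thesis
    unfolding chart_def
  proof (rule continuous_on_coordinatewise_then_product)
    fix x
    show "continuous_on S (\<lambda>y. y x +
        (if x \<in> ext A then (1 - radius (A - {p}) y - ext_min A \<epsilon> y) * of_int (\<epsilon> x) else 0))"
      by (cases "x \<in> ext A") (auto intro!: continuous_intros m r
          continuous_on_product_then_coordinatewise[OF continuous_on_id])
  qed
qed

lemma ext_min_le: "x \<in> ext A \<Longrightarrow> ext_min A \<epsilon> y \<le> of_int (\<epsilon> x) * y x"
  unfolding ext_min_def using finite_ext[OF A] by (intro Min_le) auto

lemma ext_min_attained: obtains x where "x \<in> ext A" "ext_min A \<epsilon> y = of_int (\<epsilon> x) * y x"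
proof -
  have "ext_min A \<epsilon> y \<in> (\<lambda>x. of_int (\<epsilon> x) * y x) ` ext A"
    unfolding ext_min_def using finite_ext[OF A] p by (intro Min_in) auto
  then show ?thesis using that by blast
qed

lemma ext_min_scale: "0 < s \<Longrightarrow> ext_min A \<epsilon> (\<lambda>x. s * y x) = s * ext_min A \<epsilon> y"
  using Min_image_scale[OF finite_ext[OF A], of s "\<lambda>x. of_int (\<epsilon> x) * y x"] p
  unfolding ext_min_def by (auto simp: mult.left_commute)

lemma radius_scale: "0 < s \<Longrightarrow> radius S (\<lambda>x. s * y x) = s * radius S y"
  by (simp add: radius_def power_mult_distrib sum_distrib_left[symmetric] real_sqrt_mult)

lemma chart_ext:
  assumes "x \<in> ext A"
  shows "of_int (\<epsilon> x) * chart A \<epsilon> p y x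
     = of_int (\<epsilon> x) * y x - ext_min A \<epsilon> y + (1 - radius (A - {p}) y)"
proof -
  define k where "k = 1 - radius (A - {p}) y - ext_min A \<epsilon> y"
  have "of_int (\<epsilon> x) * (k * of_int (\<epsilon> x)) = k"
    using ext_sign_mult[OF assms, of k] by (simp only: mult.commute[of k])
  then have "of_int (\<epsilon> x) * chart A \<epsilon> p y x = of_int (\<epsilon> x) * y x + k"
    using assms by (simp add: chart_def distrib_left k_def[symmetric])
  then show ?thesis by (simp add: k_def)
qed

text \<open>By \<open>chart_ext\<close> the signed coordinates of the chart on \<open>ext A\<close>
  have minimum exactly 1 - r, attained where y attains \<open>ext_min\<close>. This is nonnegative
  on the ball and positive precisely for r < 1.\<close>

lemma chart_cone:
  assumes y: "y \<in> fun_ball (A - {p})"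
  shows "chart A \<epsilon> p y \<in> cone A \<epsilon>"
    and "chart A \<epsilon> p y \<in> open_cone A \<epsilon> \<longleftrightarrow> (\<Sum>x\<in>A - {p}. (y x)\<^sup>2) < 1"
proof -
  have r: "radius (A - {p}) y \<le> 1" using y by (simp add: fun_ball_def radius_def)
  have outside: "chart A \<epsilon> p y x = 0" if "x \<notin> A" for x
    using that y ext_subset[OF A] by (auto simp: chart_def fun_ball_def)
  have ge: "1 - radius (A - {p}) y \<le> of_int (\<epsilon> x) * chart A \<epsilon> p y x" if "x \<in> ext A" for x
    using chart_ext[OF that, of y] ext_min_le[OF that, of y] by simp
  show "chart A \<epsilon> p y \<in> cone A \<epsilon>" using outside ge r by (fastforce simp: cone_def)
  obtain z where "z \<in> ext A" "ext_min A \<epsilon> y = of_int (\<epsilon> z) * y z" by (rule ext_min_attained)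
  then have z: "z \<in> ext A" "of_int (\<epsilon> z) * chart A \<epsilon> p y z = 1 - radius (A - {p}) y"
    using chart_ext[of z y] by auto
  have "chart A \<epsilon> p y \<in> open_cone A \<epsilon> \<longleftrightarrow> radius (A - {p}) y < 1"
  proof
    assume "chart A \<epsilon> p y \<in> open_cone A \<epsilon>"
    then have "0 < of_int (\<epsilon> z) * chart A \<epsilon> p y z" using z(1) unfolding open_cone_def by blast
    then show "radius (A - {p}) y < 1" using z(2) by simp
  next
    assume "radius (A - {p}) y < 1"
    then have "0 < of_int (\<epsilon> x) * chart A \<epsilon> p y x" if "x \<in> ext A" for x using ge[OF that] by simp
    then show "chart A \<epsilon> p y \<in> open_cone A \<epsilon>" using outside unfolding open_cone_def by blast
  qed
  then show "chart A \<epsilon> p y \<in> open_cone A \<epsilon> \<longleftrightarrow> (\<Sum>x\<in>A - {p}. (y x)\<^sup>2) < 1"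
    by (simp add: radius_def)
qed

text \<open>As y and y' vanish at p, the coordinate at p compares the multiples of \<epsilon> that
  were added, and subtracting them leaves y = s * y'. The radius and the minimum are homogeneous but
  the constant 1 in the height is not, which forces s = 1.\<close>

lemma chart_inj_ray:
  assumes y: "y \<in> fun_ball (A - {p})" and y': "y' \<in> fun_ball (A - {p})" and s: "0 < s"
    and eq: "\<And>x. chart A \<epsilon> p y x = s * chart A \<epsilon> p y' x"
  shows "y = y'"
proof -
  let ?k = "\<lambda>y. 1 - radius (A - {p}) y - ext_min A \<epsilon> y"
  have "y p = 0" "y' p = 0" using y y' by (auto simp: fun_ball_def)
  then have "?k y * of_int (\<epsilon> p) = s * ?k y' * of_int (\<epsilon> p)"
    using eq[of p] p by (simp add: chart_def)
  moreover have "\<epsilon> p \<noteq> 0" using signs_cases[OF \<epsilon> ext_ground[OF A p]] by auto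
  ultimately have k: "?k y = s * ?k y'" by simp
  have ys: "y = (\<lambda>x. s * y' x)"
  proof
    fix x
    show "y x = s * y' x"
    proof (cases "x \<in> ext A")
      case True
      then show ?thesis using eq[of x] unfolding chart_def k by (simp add: algebra_simps)
    next
      case False
      then show ?thesis using eq[of x] by (simp add: chart_def)
    qed
  qed
  have "?k y = 1 - s * radius (A - {p}) y' - s * ext_min A \<epsilon> y'"
    unfolding ys radius_scale[OF s] ext_min_scale[OF s] ..
  then have "s = 1" using k by (simp add: algebra_simps)
  then show ?thesis using ys by simp
qed

text \<open>If the chart vanished, its coordinate at p would show that no multiple of \<epsilon> was
  added, so y = 0; but at the centre the added multiple is 1.\<close>

lemma chart_nonzero:
  assumes y: "y \<in> fun_ball (A - {p})"
  shows "chart A \<epsilon> p y \<in> nonzero_vectors"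
proof -
  have "chart A \<epsilon> p y \<noteq> (\<lambda>_. 0)"
  proof
    assume 0: "chart A \<epsilon> p y = (\<lambda>_. 0)"
    let ?k = "1 - radius (A - {p}) y - ext_min A \<epsilon> y"
    have "y p = 0" using y by (auto simp: fun_ball_def)
    then have "?k * of_int (\<epsilon> p) = 0" using fun_cong[OF 0, of p] p by (simp add: chart_def)
    moreover have "\<epsilon> p \<noteq> 0" using signs_cases[OF \<epsilon> ext_ground[OF A p]] by auto
    ultimately have k: "?k = 0" by simp
    have "chart A \<epsilon> p y x = y x" for x unfolding chart_def k by simp
    then have y0: "y x = 0" for x using 0 by simp
    obtain z where "ext_min A \<epsilon> y = of_int (\<epsilon> z) * y z" by (rule ext_min_attained)
    then show False using k by (simp add: y0 radius_def)
  qed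
  then show ?thesis
    using chart_cone(1)[OF y] closed_subset[OF A] by (auto simp: nonzero_vectors_def cone_def)
qed

lemma chart_surj_ray:
  assumes v: "v \<in> cone A \<epsilon>" "v \<noteq> (\<lambda>_. 0)"
  obtains y s where "y \<in> fun_ball (A - {p})" "0 < s" "chart A \<epsilon> p y = (\<lambda>x. s * v x)"
proof -
  \<comment> \<open>The split v = u + a * w along the ray direction w has u p = 0, as required of
    points of the ball over A - {p}.\<close>
  define a where "a = of_int (\<epsilon> p) * v p"
  define w where "w = (\<lambda>x. if x \<in> ext A then of_int (\<epsilon> x) else 0 :: real)"
  define u where "u = (\<lambda>x. v x - a * w x)"
  let ?r = "radius (A - {p})"
  have up: "u p = 0" using p ext_sign_mult[OF p, of "v p"] by (simp add: u_def w_def a_def mult.commute mult.left_commute)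
  have uA: "u x = 0" if "x \<notin> A - {p}" for x
    using that up v(1) ext_subset[OF A] by (auto simp: u_def w_def cone_def)
  have min: "ext_min A \<epsilon> v = ext_min A \<epsilon> u + a"
  proof -
    have "of_int (\<epsilon> x) * v x = of_int (\<epsilon> x) * u x + a" if "x \<in> ext A" for x
      using that ext_sign_mult[OF that, of a] by (simp add: u_def w_def algebra_simps)
    then have "(\<lambda>x. of_int (\<epsilon> x) * v x) ` ext A = (\<lambda>x. of_int (\<epsilon> x) * u x + a) ` ext A"
      by (intro image_cong) auto
    then show ?thesis
      unfolding ext_min_def using Min_image_add[OF finite_ext[OF A], of "\<lambda>x. of_int (\<epsilon> x) * u x" a] p by auto
  qed
  have min_nonneg: "0 \<le> ext_min A \<epsilon> v"
  proof -
    obtain z where "z \<in> ext A" "ext_min A \<epsilon> v = of_int (\<epsilon> z) * v z" by (rule ext_min_attained)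
    then show ?thesis using v(1) by (auto simp: cone_def)
  qed
  have r_nonneg: "0 \<le> ?r u" by (simp add: radius_def sum_nonneg)
  \<comment> \<open>Both summands are nonnegative. If both vanish, then u = 0, the height of v is a,
    and so v = 0.\<close>
  have "ext_min A \<epsilon> v + ?r u \<noteq> 0"
  proof
    assume "ext_min A \<epsilon> v + ?r u = 0"
    then have 0: "ext_min A \<epsilon> v = 0" "?r u = 0" using min_nonneg r_nonneg by auto
    have "\<forall>x\<in>A - {p}. (u x)\<^sup>2 = 0"
      using 0(2) finite_closed[OF A] by (simp add: radius_def sum_nonneg_eq_0_iff)
    then have u0: "u x = 0" for x using uA by (cases "x \<in> A - {p}") auto
    obtain z where "ext_min A \<epsilon> u = of_int (\<epsilon> z) * u z" by (rule ext_min_attained)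
    then have "a = 0" using min 0(1) u0 by simp
    then have "v x = 0" for x using u0[of x] by (simp add: u_def)
    then show False using v(2) by auto
  qed
  then have q: "0 < ext_min A \<epsilon> v + ?r u" using min_nonneg r_nonneg by simp
  \<comment> \<open>For y = s * u the chart adds the multiple 1 - s * (r u + \<open>ext_min\<close>
    u) of w, while s * v needs s * a. Since \<open>ext_min\<close> v = \<open>ext_min\<close> u + a,
    these are equal exactly for this s.\<close>
  define s where "s = 1 / (ext_min A \<epsilon> v + ?r u)"
  have s: "0 < s" using q by (simp add: s_def)
  define y where "y = (\<lambda>x. s * u x)"
  have ry: "?r y = s * ?r u" and my: "ext_min A \<epsilon> y = s * ext_min A \<epsilon> u"
    unfolding y_def by (rule radius_scale[OF s], rule ext_min_scale[OF s])
  have "?r y \<le> 1" unfolding ry s_def using q min_nonneg by (simp add: field_simps)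
  then have "(\<Sum>x\<in>A - {p}. (y x)\<^sup>2) \<le> 1" by (simp add: radius_def)
  then have "y \<in> fun_ball (A - {p})" using uA by (simp add: fun_ball_def y_def)
  moreover have "chart A \<epsilon> p y = (\<lambda>x. s * v x)"
  proof
    fix x
    have "1 = s * (ext_min A \<epsilon> v + ?r u)" using q by (simp add: s_def)
    then have k: "1 - ?r y - ext_min A \<epsilon> y = s * a" unfolding ry my min by (simp add: algebra_simps)
    show "chart A \<epsilon> p y x = s * v x"
      unfolding chart_def k by (simp add: y_def u_def w_def algebra_simps)
  qed
  ultimately show ?thesis using that s by blast
qed

end

text \<open>Compose the coordinate ball over A - {p}, the chart into the cone, and the passage along
  rays to the realization; dropping p accounts for the dimension. The second conjunct identifies the
  open cell with the preimage of the open cone.\<close>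

lemma cell_chart:
  assumes A: "A \<in> \<L>" "A \<noteq> {}" and \<epsilon>: "\<epsilon> \<in> signs"
  shows "\<exists>\<phi>. homeomorphic_map (nball (card A - 1)) (subtopology (top_of_set R) (cell E cl A \<epsilon>)) \<phi> \<and>
    (\<forall>z\<in>topspace (nball (card A - 1)). signed_sum (\<phi> z) \<in> open_cone A \<epsilon> \<longleftrightarrow> z \<in> nball_interior (card A - 1))"
proof -
  obtain p where p: "p \<in> ext A" using ext_nonempty[OF A] by auto
  let ?W = "A - {p}" and ?d = "card A - 1"
  have fW: "finite ?W" using finite_closed[OF A(1)] by simp
  have cW: "card ?W = ?d" using p ext_subset[OF A(1)] finite_closed[OF A(1)] by (simp add: subset_eq)
  obtain f where f: "homeomorphic_map (nball (card ?W)) (top_of_set (fun_ball ?W)) f"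
    "\<forall>z. (\<Sum>x\<in>?W. (f z x)\<^sup>2) = (\<Sum>i<card ?W. (z i)\<^sup>2)"
    by (rule nball_homeomorphic_fun_ball[OF fW])
  have fim: "f ` topspace (nball ?d) = fun_ball ?W" and finj: "inj_on f (topspace (nball ?d))"
    and fcont: "continuous_map (nball ?d) (top_of_set (fun_ball ?W)) f"
    using f(1) unfolding cW by (auto simp: homeomorphic_eq_everything_map)
  obtain G where G: "continuous_on nonzero_vectors G"
    "\<forall>v\<in>nonzero_vectors. G v \<in> R \<and> (\<exists>k>0. signed_sum (G v) = (\<lambda>x. k * v x))"
    by (rule ray_section)
  let ?c = "chart A \<epsilon> p"
  define \<phi> where "\<phi> = (\<lambda>z. G (?c (f z)))"
  have fz: "f z \<in> fun_ball ?W" if "z \<in> topspace (nball ?d)" for z using fim that by auto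
  have cN: "?c ` fun_ball ?W \<subseteq> nonzero_vectors" using chart_nonzero[OF A(1) \<epsilon> p] by auto
  have \<phi>: "\<phi> z \<in> R \<and> (\<exists>k>0. signed_sum (\<phi> z) = (\<lambda>x. k * ?c (f z) x))" if "z \<in> topspace (nball ?d)" for z
    using G(2) cN fz[OF that] unfolding \<phi>_def by auto
  have cell_sub: "cell E cl A \<epsilon> \<subseteq> R" using mem_cell_iff[OF A \<epsilon>] by auto
  have into: "\<phi> z \<in> cell E cl A \<epsilon>" if z: "z \<in> topspace (nball ?d)" for z
  proof -
    obtain k where "0 < k" "signed_sum (\<phi> z) = (\<lambda>x. k * ?c (f z) x)" using \<phi>[OF z] by auto
    then show ?thesis
      using mem_cell_iff[OF A \<epsilon>] \<phi>[OF z] chart_cone(1)[OF A(1) \<epsilon> p fz[OF z]] cone_scale(1) by simp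
  qed
  have "homeomorphic_map (nball ?d) (top_of_set (cell E cl A \<epsilon>)) \<phi>"
  proof (rule continuous_imp_homeomorphic_map)
    have "continuous_on (fun_ball ?W) (\<lambda>y. G (?c y))"
      by (rule continuous_on_compose2[OF G(1) continuous_on_chart[OF A(1) \<epsilon> p] cN])
    then have "continuous_map (top_of_set (fun_ball ?W)) euclidean (\<lambda>y. G (?c y))" by simp
    then have "continuous_map (nball ?d) euclidean \<phi>"
      using continuous_map_compose[OF fcont] unfolding \<phi>_def comp_def by blast
    then show "continuous_map (nball ?d) (top_of_set (cell E cl A \<epsilon>)) \<phi>"
      using into by (auto simp: continuous_map_in_subtopology)
    have "compact_space (top_of_set (fun_ball ?W))"
      using compact_fun_ball[OF fW] by (simp add: compact_space_subtopology)
    then show "compact_space (nball ?d)"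
      using homeomorphic_compact_space[OF homeomorphic_map_imp_homeomorphic_space[OF f(1)]] cW by simp
    show "Hausdorff_space (top_of_set (cell E cl A \<epsilon>))" by (rule Hausdorff_euclidean_fun)
    have "t \<in> \<phi> ` topspace (nball ?d)" if "t \<in> cell E cl A \<epsilon>" for t
    proof -
      have t: "t \<in> R" "signed_sum t \<in> cone A \<epsilon>" "signed_sum t \<noteq> (\<lambda>_. 0)"
        using that mem_cell_iff[OF A \<epsilon>] signed_sum_nonzero by fastforce+
      obtain y s where y: "y \<in> fun_ball ?W" "0 < s" "?c y = (\<lambda>x. s * signed_sum t x)"
        by (rule chart_surj_ray[OF A(1) \<epsilon> p t(2,3)])
      have "y \<in> f ` topspace (nball ?d)" using y(1) fim by simp
      then obtain z where z: "z \<in> topspace (nball ?d)" "f z = y" by (auto elim!: imageE)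
      obtain k where k: "0 < k" "signed_sum (\<phi> z) = (\<lambda>x. k * ?c (f z) x)" using \<phi>[OF z(1)] by auto
      have "\<phi> z = t"
      proof (rule signed_sum_inj_ray)
        show "\<phi> z \<in> R" "t \<in> R" using \<phi>[OF z(1)] t by auto
        show "0 < k * s" using k(1) y(2) by simp
        show "signed_sum (\<phi> z) x = k * s * signed_sum t x" for x unfolding k(2) z(2) y(3) by simp
      qed
      then show ?thesis using z(1) by auto
    qed
    then show "\<phi> ` topspace (nball ?d) = topspace (top_of_set (cell E cl A \<epsilon>))" using into by auto
    show "inj_on \<phi> (topspace (nball ?d))"
    proof (rule inj_onI)
      fix z z' assume z: "z \<in> topspace (nball ?d)" "z' \<in> topspace (nball ?d)" and eq: "\<phi> z = \<phi> z'"
      obtain k where k: "0 < k" "signed_sum (\<phi> z) = (\<lambda>x. k * ?c (f z) x)" using \<phi>[OF z(1)] by auto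
      obtain k' where k': "0 < k'" "signed_sum (\<phi> z') = (\<lambda>x. k' * ?c (f z') x)" using \<phi>[OF z(2)] by auto
      \<comment> \<open>Equal points of the realization have proportional chart vectors, and the
        chart meets each ray at most once.\<close>
      have "f z = f z'"
      proof (rule chart_inj_ray[OF A(1) \<epsilon> p fz[OF z(1)] fz[OF z(2)], of "k' / k"])
        show "0 < k' / k" using k(1) k'(1) by simp
        show "?c (f z) x = k' / k * ?c (f z') x" for x
          using fun_cong[OF k(2), of x] fun_cong[OF k'(2), of x] eq k(1) by (simp add: field_simps)
      qed
      then show "z = z'" using finj z by (simp add: inj_on_eq_iff)
    qed
  qed
  moreover have "subtopology (top_of_set R) (cell E cl A \<epsilon>) = top_of_set (cell E cl A \<epsilon>)"
    using cell_sub by (simp add: subtopology_subtopology Int_absorb1)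
  moreover have "signed_sum (\<phi> z) \<in> open_cone A \<epsilon> \<longleftrightarrow> z \<in> nball_interior ?d" if z: "z \<in> topspace (nball ?d)" for z
  proof -
    obtain k where "0 < k" "signed_sum (\<phi> z) = (\<lambda>x. k * ?c (f z) x)" using \<phi>[OF z] by auto
    then have "signed_sum (\<phi> z) \<in> open_cone A \<epsilon> \<longleftrightarrow> ?c (f z) \<in> open_cone A \<epsilon>" using cone_scale(2) by simp
    also have "\<dots> \<longleftrightarrow> (\<Sum>i<?d. (z i)\<^sup>2) < 1"
      using chart_cone(2)[OF A(1) \<epsilon> p fz[OF z]] f(2) cW by simp
    finally show ?thesis using z by (simp add: nball_interior_def)
  qed
  ultimately show ?thesis by metis
qed

section \<open>The regular CW structure\<close>

lemma finite_Sigma_cells: "finite (Sigma_cells E cl)"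
proof -
  have "Sigma_cells E cl \<subseteq> (\<lambda>(A, \<epsilon>). cell E cl A \<epsilon>) ` (\<L> \<times> signs)" by (auto simp: Sigma_cells_def)
  then show ?thesis using finite_closed_sets finite_signs by (meson finite_SigmaI finite_imageI finite_subset)
qed

lemma closedin_cell:
  assumes "A \<in> \<L>" "A \<noteq> {}" "\<epsilon> \<in> signs"
  shows "closedin (top_of_set R) (cell E cl A \<epsilon>)"
proof -
  obtain \<phi> where "homeomorphic_map (nball (card A - 1)) (subtopology (top_of_set R) (cell E cl A \<epsilon>)) \<phi>"
    using cell_chart[OF assms] by blast
  moreover have "compact_space (nball d)" for d
  proof -
    obtain f where f: "homeomorphic_map (nball (card {..<d})) (top_of_set (fun_ball {..<d})) f"
      by (rule nball_homeomorphic_fun_ball[of "{..<d}"]) auto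
    have "compact_space (top_of_set (fun_ball {..<d}))"
      using compact_fun_ball[of "{..<d}"] by (simp add: compact_space_subtopology)
    then show ?thesis
      using homeomorphic_compact_space[OF homeomorphic_map_imp_homeomorphic_space[OF f]] by simp
  qed
  ultimately have "compact_space (subtopology (top_of_set R) (cell E cl A \<epsilon>))"
    using homeomorphic_compact_space homeomorphic_map_imp_homeomorphic_space by blast
  moreover have "cell E cl A \<epsilon> \<subseteq> R" using mem_cell_iff[OF assms] by auto
  ultimately have "compactin (top_of_set R) (cell E cl A \<epsilon>)"
    by (simp add: compactin_subspace)
  then show ?thesis using compactin_imp_closedin Hausdorff_euclidean_fun by blast
qed

text \<open>With open cells as preimages of open cones, the partition property says that a vector
  determines its closed set and its signs on the extreme points. At a boundary point the support
  spans a smaller closed set, so the dimension drops. The weak topology comes from having finitely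
  many closed cells.\<close>

lemma regular_CW_complex_Sigma: "regular_CW_complex (top_of_set R) (Sigma_cells E cl)"
proof -
  let ?X = "top_of_set R" and ?\<Sigma> = "Sigma_cells E cl"
  have "\<forall>C\<in>?\<Sigma>. \<exists>q. fst q \<in> \<L> \<and> fst q \<noteq> {} \<and> snd q \<in> signs \<and> C = cell E cl (fst q) (snd q)"
    by (fastforce simp: Sigma_cells_def)
  from bchoice[OF this] obtain q where q: "\<forall>C\<in>?\<Sigma>. fst (q C) \<in> \<L> \<and> fst (q C) \<noteq> {} \<and> snd (q C) \<in> signs \<and>
      C = cell E cl (fst (q C)) (snd (q C))" ..
  define Y where "Y = (\<lambda>C. fst (q C))"
  define \<eta> where "\<eta> = (\<lambda>C. snd (q C))"
  have Y: "Y C \<in> \<L>" "Y C \<noteq> {}" "\<eta> C \<in> signs" "C = cell E cl (Y C) (\<eta> C)" if "C \<in> ?\<Sigma>" for C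
    using q that by (auto simp: Y_def \<eta>_def)
  define dm where "dm = (\<lambda>C. card (Y C) - 1)"
  have "\<forall>C\<in>?\<Sigma>. \<exists>\<phi>. homeomorphic_map (nball (dm C)) (subtopology ?X C) \<phi> \<and>
      (\<forall>z\<in>topspace (nball (dm C)). signed_sum (\<phi> z) \<in> open_cone (Y C) (\<eta> C) \<longleftrightarrow> z \<in> nball_interior (dm C))"
  proof
    fix C assume "C \<in> ?\<Sigma>"
    from cell_chart[OF Y(1,2,3)[OF this]]
    show "\<exists>\<phi>. homeomorphic_map (nball (dm C)) (subtopology ?X C) \<phi> \<and>
      (\<forall>z\<in>topspace (nball (dm C)). signed_sum (\<phi> z) \<in> open_cone (Y C) (\<eta> C) \<longleftrightarrow> z \<in> nball_interior (dm C))"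
      unfolding dm_def Y(4)[OF \<open>C \<in> ?\<Sigma>\<close>, symmetric] .
  qed
  from bchoice[OF this] obtain \<Phi> where \<Phi>: "\<forall>C\<in>?\<Sigma>. homeomorphic_map (nball (dm C)) (subtopology ?X C) (\<Phi> C) \<and>
      (\<forall>z\<in>topspace (nball (dm C)). signed_sum (\<Phi> C z) \<in> open_cone (Y C) (\<eta> C) \<longleftrightarrow> z \<in> nball_interior (dm C))" ..
  define O' where "O' = (\<lambda>C. {t \<in> R. signed_sum t \<in> open_cone (Y C) (\<eta> C)})"
  have mem: "t \<in> C \<longleftrightarrow> t \<in> R \<and> signed_sum t \<in> cone (Y C) (\<eta> C)" if "C \<in> ?\<Sigma>" for C t
    using mem_cell_iff[OF Y(1,2,3)[OF that]] Y(4)[OF that] by metis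
  have sub: "C \<subseteq> R" if "C \<in> ?\<Sigma>" for C using mem[OF that] by blast
  have image: "\<Phi> C ` topspace (nball (dm C)) = C" if "C \<in> ?\<Sigma>" for C
    using homeomorphic_imp_surjective_map[of "nball (dm C)" "subtopology ?X C" "\<Phi> C"] \<Phi> that sub[OF that] by auto
  have open_sub: "O' C \<subseteq> C" if "C \<in> ?\<Sigma>" for C
    using mem[OF that] by (auto simp: O'_def cone_def open_cone_def less_imp_le)
  have open_image: "\<Phi> C ` nball_interior (dm C) = O' C" if C: "C \<in> ?\<Sigma>" for C
  proof
    show "\<Phi> C ` nball_interior (dm C) \<subseteq> O' C"
    proof clarify
      fix z assume z: "z \<in> nball_interior (dm C)"
      then have "z \<in> topspace (nball (dm C))" by (simp add: nball_interior_def)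
      then show "\<Phi> C z \<in> O' C" using \<Phi> C z image[OF C] sub[OF C] unfolding O'_def by blast
    qed
    show "O' C \<subseteq> \<Phi> C ` nball_interior (dm C)"
    proof
      fix t assume t: "t \<in> O' C"
      then obtain z where z: "z \<in> topspace (nball (dm C))" "t = \<Phi> C z"
        using image[OF C] open_sub[OF C] by blast
      then have "z \<in> nball_interior (dm C)" using \<Phi> C t by (simp add: O'_def)
      then show "t \<in> \<Phi> C ` nball_interior (dm C)" using z(2) by blast
    qed
  qed
  have carrier: "\<exists>D\<in>?\<Sigma>. t \<in> O' D \<and> Y D = cl {x. signed_sum t x \<noteq> 0}" if t: "t \<in> R" for t
  proof -
    let ?B = "cl {x. signed_sum t x \<noteq> 0}" and ?s = "sign_of (signed_sum t)"
    have supp: "{x. signed_sum t x \<noteq> 0} \<subseteq> E" using nonzero_vectors_subset(1)[OF signed_sum_nonzero_vectors[OF t]] .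
    have B: "?B \<in> \<L>" using cl_closed[OF supp] .
    have Bne: "?B \<noteq> {}" using cl_extensive[OF supp] signed_sum_nonzero[OF t] by auto
    let ?D = "cell E cl ?B ?s"
    have D: "?D \<in> ?\<Sigma>" unfolding Sigma_cells_def using B Bne sign_of_signs by blast
    \<comment> \<open>The representative chosen for this cell may differ from the sign vector of t.
      Equal cells come from equal classes, and the open cone depends only on the class.\<close>
    have "vertex (Y ?D) (\<eta> ?D) = vertex ?B ?s"
      using cell_eq_iff[of "Y ?D" "\<eta> ?D" ?B ?s] Y[OF D] B Bne sign_of_signs by auto
    then have eq: "Y ?D = ?B" "\<forall>x\<in>ext ?B. \<eta> ?D x = ?s x"
      using vertex_eq_iff[OF Y(1,3)[OF D] B sign_of_signs] by auto
    have "signed_sum t \<in> open_cone ?B ?s" by (rule open_cone_exists[OF supp])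
    then have "signed_sum t \<in> open_cone (Y ?D) (\<eta> ?D)" using eq by (auto simp: open_cone_def)
    then show ?thesis using D t eq(1) unfolding O'_def by blast
  qed
  have disj: "disjoint_family_on O' ?\<Sigma>"
    unfolding disjoint_family_on_def
  proof (intro ballI impI)
    fix C D assume C: "C \<in> ?\<Sigma>" and D: "D \<in> ?\<Sigma>" and "C \<noteq> D"
    show "O' C \<inter> O' D = {}"
    proof (rule ccontr)
      assume "O' C \<inter> O' D \<noteq> {}"
      then obtain t where "signed_sum t \<in> open_cone (Y C) (\<eta> C)" "signed_sum t \<in> open_cone (Y D) (\<eta> D)"
        by (auto simp: O'_def)
      note u = open_cone_unique[OF Y(1)[OF C] this(1) Y(3)[OF C] Y(1)[OF D] this(2) Y(3)[OF D]]
      then have "vertex (Y C) (\<eta> C) = vertex (Y D) (\<eta> D)"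
        using vertex_eq_iff[OF Y(1,3)[OF C] Y(1,3)[OF D]] by auto
      then have "cell E cl (Y C) (\<eta> C) = cell E cl (Y D) (\<eta> D)"
        using cell_eq_iff[of "Y C" "\<eta> C" "Y D" "\<eta> D"] Y[OF C] Y[OF D] by blast
      then show False using \<open>C \<noteq> D\<close> Y(4)[OF C] Y(4)[OF D] by simp
    qed
  qed
  have boundary: "\<Phi> C ` nball_boundary (dm C) \<subseteq> (\<Union>D\<in>{D \<in> ?\<Sigma>. dm D < dm C}. O' D)" if C: "C \<in> ?\<Sigma>" for C
  proof clarify
    fix z assume "z \<in> nball_boundary (dm C)"
    then have z: "z \<in> topspace (nball (dm C))" "z \<notin> nball_interior (dm C)"
      by (auto simp: nball_boundary_def nball_interior_def)
    let ?t = "\<Phi> C z"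
    have t: "?t \<in> R" "signed_sum ?t \<in> cone (Y C) (\<eta> C)" "signed_sum ?t \<notin> open_cone (Y C) (\<eta> C)"
      using image[OF C] z mem[OF C] \<Phi> C by blast+
    obtain D where D: "D \<in> ?\<Sigma>" "?t \<in> O' D" "Y D = cl {x. signed_sum ?t x \<noteq> 0}" using carrier[OF t(1)] by blast
    have "Y D \<subset> Y C" using cone_not_open[OF Y(1)[OF C] t(2,3) Y(3)[OF C]] D(3) by simp
    then have "card (Y D) < card (Y C)" using finite_closed[OF Y(1)[OF C]] psubset_card_mono by blast
    \<comment> \<open>The dimension is a truncated difference, and \<open>card - 1\<close> is
      strictly increasing only on positive cardinalities.\<close>
    moreover have "0 < card (Y D)" using Y(1,2)[OF D(1)] finite_closed by (simp add: card_gt_0_iff)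
    ultimately have "dm D < dm C" by (simp add: dm_def)
    then show "?t \<in> (\<Union>D\<in>{D \<in> ?\<Sigma>. dm D < dm C}. O' D)" using D by blast
  qed
  have closed: "closedin ?X C" if "C \<in> ?\<Sigma>" for C
    using closedin_cell[OF Y(1,2,3)[OF that]] Y(4)[OF that] by metis
  have cover: "(\<Union>C\<in>?\<Sigma>. O' C) = R" using carrier by (auto simp: O'_def)
  have weak: "closedin ?X S \<longleftrightarrow> (\<forall>C\<in>?\<Sigma>. closedin ?X (S \<inter> C))" if S: "S \<subseteq> R" for S
  proof
    show "\<forall>C\<in>?\<Sigma>. closedin ?X (S \<inter> C)" if "closedin ?X S" using that closed closedin_Int by blast
    assume "\<forall>C\<in>?\<Sigma>. closedin ?X (S \<inter> C)"
    then have "closedin ?X (\<Union>C\<in>?\<Sigma>. S \<inter> C)" using finite_Sigma_cells by (intro closedin_Union) auto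
    moreover have "\<exists>C\<in>?\<Sigma>. t \<in> C" if "t \<in> S" for t
    proof -
      obtain D where "D \<in> ?\<Sigma>" "t \<in> O' D" using carrier \<open>t \<in> S\<close> S by blast
      then show ?thesis using open_sub by blast
    qed
    then have "(\<Union>C\<in>?\<Sigma>. S \<inter> C) = S" by auto
    ultimately show "closedin ?X S" by (simp only:)
  qed
  show ?thesis
    unfolding regular_CW_complex_def
  proof (intro conjI exI[of _ dm] exI[of _ \<Phi>] ballI allI impI)
    show "Hausdorff_space ?X" by (rule Hausdorff_euclidean_fun)
    show "C \<subseteq> topspace ?X" if "C \<in> ?\<Sigma>" for C using sub[OF that] by simp
    show "homeomorphic_map (nball (dm C)) (subtopology ?X C) (\<Phi> C)" if "C \<in> ?\<Sigma>" for C using \<Phi> that by blast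
    show "disjoint_family_on (\<lambda>C. \<Phi> C ` nball_interior (dm C)) ?\<Sigma>"
      using disj open_image by (simp add: disjoint_family_on_def)
    show "(\<Union>C\<in>?\<Sigma>. \<Phi> C ` nball_interior (dm C)) = topspace ?X" using cover open_image by simp
    show "\<exists>F. finite F \<and> F \<subseteq> {D \<in> ?\<Sigma>. dm D < dm C} \<and>
        \<Phi> C ` nball_boundary (dm C) \<subseteq> (\<Union>D\<in>F. \<Phi> D ` nball_interior (dm D))" if "C \<in> ?\<Sigma>" for C
      using boundary[OF that] open_image finite_Sigma_cells
      by (intro exI[of _ "{D \<in> ?\<Sigma>. dm D < dm C}"]) auto
    show "closedin ?X S \<longleftrightarrow> (\<forall>C\<in>?\<Sigma>. closedin ?X (S \<inter> C))" if "S \<subseteq> topspace ?X" for S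
      using weak that by simp
  qed
qed

end

theorem theorem3p5:
  fixes E :: "'a::{finite,complete_lattice} set" and cl :: "'a set \<Rightarrow> 'a set"
  assumes "meet_distributive TYPE('a)"
    and "CARD('a) > 1"
    and "E = {j. join_irreducible j}"
    and "cl = ji_closure"
  shows "regular_CW_sphere (top_of_set (realization (pm_Delta E cl))) (Sigma_cells E cl) \<and>
    (\<exists>\<phi>. (\<forall>A \<in> closed_sets E cl - {{}}. \<forall>\<epsilon> \<in> sign_vectors E.
            \<phi> (Elt (signed_set E cl A \<epsilon>)) = cell E cl A \<epsilon>) \<and>
         poset_isomorphism (Q_poset E cl - {Q_bot E, Hat1}) (Q_le cl) (Sigma_cells E cl) (\<subseteq>) \<phi> \<and>
         simplicial_isomorphism (pm_Delta E cl) (order_complex (Sigma_cells E cl)) (\<lambda>v. \<phi> (Elt v)))"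
proof -
  interpret convex_closure E cl
    unfolding assms(3,4) by (rule convex_closure_ji_closure[OF assms(1)])
  \<comment> \<open>A lattice with one element would have no join-irreducibles and an empty
    realization, which is not \<open>nsphere d\<close> for any natural number d.\<close>
  have "(top :: 'a) \<noteq> bot"
  proof
    assume "(top :: 'a) = bot"
    then have "x = bot" for x :: 'a by (metis bot_unique top_greatest)
    then have "(UNIV :: 'a set) = {bot}" by auto
    then have "CARD('a) = card {bot :: 'a}" by (rule arg_cong)
    then show False using assms(2) by simp
  qed
  then have "\<not> (top :: 'a) \<le> bot" by (simp add: bot_unique)
  then obtain j :: 'a where "join_irreducible j" by (rule exists_join_irreducible)
  then have "E \<noteq> {}" using assms(3) by auto
  then have "regular_CW_sphere (top_of_set R) (Sigma_cells E cl)"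
    unfolding regular_CW_sphere_def using regular_CW_complex_Sigma realization_sphere by blast
  moreover have "\<forall>A \<in> \<L> - {{}}. \<forall>\<epsilon> \<in> signs. cell_of (Elt (vertex A \<epsilon>)) = cell E cl A \<epsilon>"
    using cell_of_vertex by blast
  ultimately show ?thesis using face_poset barycentric_subdivision by blast
qed

end
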